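(* Suppose that, as $q\to1$ (with $q\in[0,1)$), a finite set $X=\{x_1,\dots,x_m\}\subset\mathbb{Z}+\tfrac12$ (of $m$ distinct elements, $m$ fixed) varies with $q$ in such a way that all limits $$\frac{x_i}{\sqrt N}\to\xi_i,\qquad i=1,\dots,m,\quad q\to1,$$ exist, where $N=N(q)=\frac1{24}+G_2(q)$ is the expectation of $|\lambda|$ with respect to $\mathcal{M}_q$. Then $$\lim_{q\to1}\varrho(X,q)=\prod_{i=1}^m\left(1+\exp\left(\frac{\pi|\xi_i|}{\sqrt6}\right)\right)^{-1}.$$
   Context: For $q\in[0,1)$, $\mathcal{M}_q(\lambda)=(q;q)_\infty\,q^{|\lambda|}$ is a probability measure on the set of all partitions $\lambda$, where $(q;q)_\infty=\prod_{n\ge1}(1-q^n)$. For a partition $\lambda$ put $\mathfrak{S}(\lambda)=\{\lambda_i-i+\frac12:i\ge1\}\subset\mathbb{Z}+\frac12$, $\mathfrak{S}(\lambda)_+=\mathfrak{S}(\lambda)\setminus\{-\frac12,-\frac32,\dots\}$, $\mathfrak{S}(\lambda)_-=\{-\frac12,-\frac32,\dots\}\setminus\mathfrak{S}(\lambda)$. The modified Frobenius coordinates of $\lambda$ are $\mathrm{Fr}\,\lambda=\mathfrak{S}(\lambda)_+\cup\mathfrak{S}(\lambda)_-$. The correlation function is $\varrho(X,q)=\mathcal{M}_q(\{\lambda:X\subset\mathrm{Fr}\,\lambda\})=(q;q)_\infty\sum_{\lambda:\,\mathrm{Fr}\,\lambda\supset X}q^{|\lambda|}$. Here $G_2(q)=\frac{\zeta(-1)}2+\sum_{n\ge1}q^n\sum_{d|n}d=-\frac1{24}+\sum_{n\ge1}q^n\sum_{d|n}d$,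 so $N(q)=(q;q)_\infty\sum_\lambda|\lambda|q^{|\lambda|}=\sum_{n\ge1}q^n\sum_{d|n}d$. *)

theory Defs
  imports "HOL-Probability.Probability"
begin

text \<open>
  A partition is a weakly decreasing, finitely supported sequence. Sequences are indexed
  from 0, so that \<open>lam i\<close> is the part usually written \<open>\<lambda>\<^sub>i\<^sub>+\<^sub>1\<close>.
\<close>

definition partitions :: "(nat \<Rightarrow> nat) set" where
  "partitions = {lam. antimono lam \<and> finite {i. lam i \<noteq> 0}}"

definition psize :: "(nat \<Rightarrow> nat) \<Rightarrow> nat" where
  "psize lam = (\<Sum>i | lam i \<noteq> 0. lam i)"

definition half_ints :: "real set" where
  "half_ints = range (\<lambda>k::int. of_int k + 1/2)"

definition neg_half_ints :: "real set" where
  "neg_half_ints = range (\<lambda>k::nat. - (real k + 1/2))"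

text \<open>The set of all \<open>\<lambda>\<^sub>i - i + 1/2\<close>, \<open>i \<ge> 1\<close>, after the index shift.\<close>

definition maya :: "(nat \<Rightarrow> nat) \<Rightarrow> real set" where
  "maya lam = range (\<lambda>i. real (lam i) - real (Suc i) + 1/2)"

definition maya_pos :: "(nat \<Rightarrow> nat) \<Rightarrow> real set" where
  "maya_pos lam = maya lam - neg_half_ints"

definition maya_neg :: "(nat \<Rightarrow> nat) \<Rightarrow> real set" where
  "maya_neg lam = neg_half_ints - maya lam"

definition Fr :: "(nat \<Rightarrow> nat) \<Rightarrow> real set" where
  "Fr lam = maya_pos lam \<union> maya_neg lam"

definition qpoch_inf :: "real \<Rightarrow> real" where
  "qpoch_inf q = (\<Prod>n. 1 - q ^ Suc n)"

definition Mq :: "real \<Rightarrow> (nat \<Rightarrow> nat) measure" where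
  "Mq q = point_measure partitions (\<lambda>lam. ennreal (qpoch_inf q * q ^ psize lam))"

definition corr :: "real set \<Rightarrow> real \<Rightarrow> real" where
  "corr X q = measure (Mq q) {lam \<in> partitions. X \<subseteq> Fr lam}"

text \<open>The constant \<open>-1/24\<close> is \<open>\<zeta>(-1)/2\<close>.\<close>

definition G2 :: "real \<Rightarrow> real" where
  "G2 q = - 1/24 + (\<Sum>n. q ^ Suc n * real (\<Sum>d | d dvd Suc n. d))"

text \<open>This is the expectation of \<open>psize\<close> under \<open>Mq q\<close> for \<open>0 \<le> q < 1\<close>.\<close>

definition mean_size :: "real \<Rightarrow> real" where
  "mean_size q = 1/24 + G2 q"

end

theory Submission imports Defs begin

text \<open>
  A half-integer \<open>k + 1/2\<close> is represented by the integer \<open>k\<close>. Frobenius coordinates identify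
  partitions with the finite sets \<open>F\<close> of sites of total charge 0, where a site has charge
  1 or -1 according to its sign and \<open>psize\<close> becomes the energy, the sum of \<open>\<bar>k + 1/2\<bar>\<close>.
  So \<open>Mq q\<close> is a family of independent Bernoulli sites with odds \<open>q powr \<bar>k + 1/2\<bar>\<close>,
  conditioned on charge 0, and it remains to see that the conditioning disappears in the limit.

  Let \<open>Z S c\<close> be the weight of the configurations of charge \<open>c\<close> in \<open>S\<close>. Translating the Maya diagram
  gives \<open>Z UNIV (c + 1) = q powr (c + 1/2) * Z UNIV c\<close>. Each \<open>Z S\<close> is log-concave in \<open>c\<close>, being
  a convolution of two-point sequences. If \<open>a\<close> arises from \<open>A\<close> by removing a site, then
  \<open>A (c + 1) / A c\<close> is a mediant of two consecutive ratios of \<open>a\<close>, and these are monotone by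
  log-concavity, so that the ratios of \<open>a\<close> are squeezed between ratios of \<open>A\<close>. Hence after removal of
  \<open>m\<close> sites the ratios are still within powers of \<open>q\<close> with exponents depending only on \<open>c\<close> and \<open>m\<close>, and
  the correlation function is the product of the Bernoulli probabilities up to a factor
  between \<open>q powr K\<close> and \<open>q powr (-K)\<close>, \<open>K\<close> depending on \<open>m\<close> only.

  Finally \<open>mean_size q\<close> is the Lambert series \<open>\<Sum>q^n / (1 - q^n)^2\<close>, which Tannery's theorem shows
  to be asymptotic to \<open>pi^2 / (6 * (1 - q)^2)\<close>.
\<close>

section \<open>Configurations of charged sites\<close>

text \<open>Monotone convergence for unordered sums: a finite set carrying the sum up to
  \<open>e/2\<close> already lies in one \<open>A N\<close>. It serves twice, for finite windows of
  sites and for partitions with boundedly many rows.\<close>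

lemma infsum_UNION_incseq_LIMSEQ:
  fixes f :: "'a \<Rightarrow> real"
  assumes inc: "incseq A" and sm: "f summable_on (\<Union>n. A n)"
    and nn: "\<And>x. x \<in> (\<Union>n. A n) \<Longrightarrow> 0 \<le> f x"
  shows "(\<lambda>n. infsum f (A n)) \<longlonglongrightarrow> infsum f (\<Union>n. A n)"
proof (rule LIMSEQ_I)
  fix e :: real assume e: "0 < e"
  let ?U = "\<Union>n. A n"
  have smA: "f summable_on A n" for n
    by (rule summable_on_subset_banach[OF sm]) auto
  obtain G where G: "finite G" "G \<subseteq> ?U" "dist (sum f G) (infsum f ?U) \<le> e/2"
    using infsum_finite_approximation[OF sm, of "e/2"] e by auto
  have "\<exists>N. G \<subseteq> A N"
    using G(1,2)
  proof (induction G)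
    case (insert x G)
    then obtain N M where "G \<subseteq> A N" "x \<in> A M" by auto
    moreover have "A N \<subseteq> A (max N M)" "A M \<subseteq> A (max N M)"
      using inc by (auto simp: incseq_def)
    ultimately show ?case by blast
  qed simp
  then obtain N where N: "G \<subseteq> A N" ..
  have "norm (infsum f (A n) - infsum f ?U) < e" if "N \<le> n" for n
  proof -
    have sub: "G \<subseteq> A n" using N inc that by (meson incseq_def subset_trans)
    have "sum f G \<le> infsum f (A n)"
      using smA G(1) sub nn by (intro finite_sum_le_infsum) auto
    moreover have "infsum f (A n) \<le> infsum f ?U"
      using smA sm nn by (intro infsum_mono_neutral) auto
    ultimately show ?thesis using G(3) e by (auto simp: dist_real_def)
  qed
  thus "\<exists>N. \<forall>n\<ge>N. norm (infsum f (A n) - infsum f ?U) < e" by blast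
qed

definition site_charge :: "int \<Rightarrow> int" where
  "site_charge k = (if 0 \<le> k then 1 else - 1)"

definition charge :: "int set \<Rightarrow> int" where
  "charge F = (\<Sum>k\<in>F. site_charge k)"

definition energy :: "int set \<Rightarrow> real" where
  "energy F = (\<Sum>k\<in>F. \<bar>of_int k + 1/2\<bar>)"

definition confs :: "int set \<Rightarrow> int \<Rightarrow> int set set" where
  "confs S c = {F. finite F \<and> F \<subseteq> S \<and> charge F = c}"

text \<open>The coefficient of \<open>z^c\<close> in the product over the sites of
  \<open>1 + z^s * y\<close>, with \<open>s\<close> the charge and \<open>y\<close> the weight of a
  site. For \<open>S = UNIV\<close> this is the product in Jacobi's triple product identity.\<close>

definition Z :: "real \<Rightarrow> int set \<Rightarrow> int \<Rightarrow> real" where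
  "Z q S c = (\<Sum>\<^sub>\<infinity>F\<in>confs S c. q powr energy F)"

lemma charge_empty [simp]: "charge {} = 0"
  and energy_empty [simp]: "energy {} = 0"
  by (simp_all add: charge_def energy_def)

lemma charge_insert [simp]: "finite F \<Longrightarrow> k \<notin> F \<Longrightarrow> charge (insert k F) = site_charge k + charge F"
  and energy_insert [simp]: "finite F \<Longrightarrow> k \<notin> F \<Longrightarrow> energy (insert k F) = \<bar>of_int k + 1/2\<bar> + energy F"
  by (simp_all add: charge_def energy_def)

lemma charge_Un_disjoint:
  "finite F \<Longrightarrow> finite G \<Longrightarrow> F \<inter> G = {} \<Longrightarrow> charge (F \<union> G) = charge F + charge G"
  and energy_Un_disjoint:
  "finite F \<Longrightarrow> finite G \<Longrightarrow> F \<inter> G = {} \<Longrightarrow> energy (F \<union> G) = energy F + energy G"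
  by (simp_all add: charge_def energy_def sum.union_disjoint)

lemma abs_charge_le: "\<bar>charge F\<bar> \<le> int (card F)"
proof -
  have "\<bar>charge F\<bar> \<le> (\<Sum>k\<in>F. \<bar>site_charge k\<bar>)" unfolding charge_def by (rule sum_abs)
  also have "\<dots> = (\<Sum>k\<in>F. 1)" by (rule sum.cong) (auto simp: site_charge_def)
  finally show ?thesis by simp
qed

text \<open>The sites \<open>n\<close> and \<open>- n - 1\<close> both have energy
  \<open>n + 1/2\<close>, which gives two copies of one geometric series.\<close>

lemma site_weights_summable:
  fixes q :: real
  assumes "0 < q" "q < 1"
  shows "(\<lambda>k::int. q powr \<bar>of_int k + 1/2\<bar>) summable_on UNIV"
proof -
  let ?y = "\<lambda>k::int. q powr \<bar>of_int k + 1/2\<bar>"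
  have s: "(\<lambda>n. q ^ n * q powr (1/2)) summable_on (UNIV :: nat set)"
    by (rule norm_summable_imp_summable_on)
      (use assms in \<open>auto simp: norm_mult norm_power intro!: summable_mult2 summable_geometric\<close>)
  have e1: "?y (int n) = q ^ n * q powr (1/2)" for n
    using assms by (simp add: powr_add powr_realpow)
  have e2: "?y (- int n - 1) = q ^ n * q powr (1/2)" for n
  proof -
    have "\<bar>real_of_int (- int n - 1) + 1/2\<bar> = real n + 1/2" by simp
    thus ?thesis using assms by (simp only: powr_add powr_realpow)
  qed
  have "?y summable_on range int"
    using s by (subst summable_on_reindex) (simp_all only: o_def e1, simp_all)
  moreover have "?y summable_on range (\<lambda>n. - int n - 1)"
    using s by (subst summable_on_reindex) (auto simp only: o_def e2 inj_on_def)
  ultimately have "?y summable_on (range int \<union> range (\<lambda>n. - int n - 1))"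
    by (rule summable_on_union)
  moreover have "k \<in> range int \<union> range (\<lambda>n. - int n - 1)" for k
  proof (cases "0 \<le> k")
    case True
    hence "k = int (nat k)" by simp
    thus ?thesis by blast
  next
    case False
    hence "k = - int (nat (- k - 1)) - 1" by simp
    thus ?thesis by blast
  qed
  hence "range int \<union> range (\<lambda>n. - int n - 1) = UNIV" by blast
  ultimately show ?thesis by simp
qed

text \<open>Finitely many configurations live on a finite set of sites, all of whose subsets
  together weigh the product of \<open>1 + y\<close> over the site weights \<open>y\<close>. The
  inequality \<open>1 + y \<le> exp y\<close> bounds this uniformly.\<close>

lemma powr_energy_summable:
  fixes q :: real
  assumes "0 < q" "q < 1"
  shows "(\<lambda>F. q powr energy F) summable_on {F. finite F}"
proof (rule nonneg_bdd_above_summable_on)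
  let ?y = "\<lambda>k::int. q powr \<bar>of_int k + 1/2\<bar>"
  have "sum (\<lambda>F. q powr energy F) G \<le> exp (infsum ?y UNIV)"
    if G: "G \<subseteq> {F. finite F}" "finite G" for G
  proof -
    let ?U = "\<Union>G"
    have fU: "finite ?U" using G by auto
    have "sum (\<lambda>F. q powr energy F) G \<le> sum (\<lambda>F. q powr energy F) (Pow ?U)"
      using fU by (intro sum_mono2) auto
    also have "\<dots> = (\<Sum>F\<in>Pow ?U. (\<Prod>k\<in>F. ?y k) * (\<Prod>k\<in>?U - F. 1))"
    proof (rule sum.cong)
      fix F assume "F \<in> Pow ?U"
      hence "finite F" using fU finite_subset by auto
      thus "q powr energy F = (\<Prod>k\<in>F. ?y k) * (\<Prod>k\<in>?U - F. 1)"
        using assms by (simp add: energy_def powr_sum)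
    qed simp
    also have "\<dots> = (\<Prod>k\<in>?U. ?y k + 1)" by (rule prod_add[OF fU, symmetric])
    also have "\<dots> \<le> (\<Prod>k\<in>?U. exp (?y k))"
      by (intro prod_mono) (auto simp: add.commute)
    also have "\<dots> = exp (\<Sum>k\<in>?U. ?y k)" using fU by (simp add: exp_sum)
    also have "\<dots> \<le> exp (infsum ?y UNIV)"
      using site_weights_summable[OF assms] fU
      by (intro iffD2[OF exp_le_cancel_iff] finite_sum_le_infsum) auto
    finally show ?thesis .
  qed
  thus "bdd_above (sum (\<lambda>F. q powr energy F) ` {G. G \<subseteq> {F. finite F} \<and> finite G})"
    by (intro bdd_aboveI[of _ "exp (infsum ?y UNIV)"]) auto
qed auto

lemma confs_summable:
  fixes q :: real
  assumes "0 < q" "q < 1"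
  shows "(\<lambda>F. q powr energy F) summable_on confs S c"
  by (rule summable_on_subset_banach[OF powr_energy_summable[OF assms]]) (auto simp: confs_def)

text \<open>Configurations are split by whether \<open>k\<close> is occupied. Log-concavity and the
  removal of sites both rest on this recursion.\<close>

lemma Z_insert:
  assumes q: "0 < q" "q < 1" and k: "k \<notin> S"
  shows "Z q (insert k S) c = Z q S c + q powr \<bar>of_int k + 1/2\<bar> * Z q S (c - site_charge k)"
proof -
  let ?f = "\<lambda>F. q powr energy F"
  have split: "confs (insert k S) c = confs S c \<union> insert k ` confs S (c - site_charge k)"
  proof
    show "confs (insert k S) c \<subseteq> confs S c \<union> insert k ` confs S (c - site_charge k)"
    proof
      fix F assume F: "F \<in> confs (insert k S) c"
      show "F \<in> confs S c \<union> insert k ` confs S (c - site_charge k)"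
      proof (cases "k \<in> F")
        case True
        have "charge (insert k (F - {k})) = site_charge k + charge (F - {k})"
          using F by (intro charge_insert) (auto simp: confs_def)
        hence "F - {k} \<in> confs S (c - site_charge k)" "F = insert k (F - {k})"
          using F True by (auto simp: confs_def insert_absorb)
        thus ?thesis by blast
      qed (use F in \<open>auto simp: confs_def\<close>)
    qed
    show "confs S c \<union> insert k ` confs S (c - site_charge k) \<subseteq> confs (insert k S) c"
    proof
      fix F assume "F \<in> confs S c \<union> insert k ` confs S (c - site_charge k)"
      thus "F \<in> confs (insert k S) c"
      proof
        assume "F \<in> insert k ` confs S (c - site_charge k)"
        then obtain G where G: "G \<in> confs S (c - site_charge k)" "F = insert k G" by blast
        moreover have "k \<notin> G" "finite G" using G k by (auto simp: confs_def)
        ultimately show ?thesis by (auto simp: confs_def)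
      qed (auto simp: confs_def)
    qed
  qed
  have disj: "confs S c \<inter> insert k ` confs S (c - site_charge k) = {}"
    using k by (auto simp: confs_def)
  have inj: "inj_on (insert k) (confs S (c - site_charge k))"
    by (rule inj_on_inverseI[where g = "\<lambda>F. F - {k}"]) (use k in \<open>auto simp: confs_def\<close>)
  have sm: "?f summable_on insert k ` confs S (c - site_charge k)"
    by (rule summable_on_subset_banach[OF confs_summable[OF q, of "insert k S" c]]) (simp add: split)
  have "infsum ?f (insert k ` confs S (c - site_charge k)) = (\<Sum>\<^sub>\<infinity>F\<in>confs S (c - site_charge k). ?f (insert k F))"
    by (subst infsum_reindex[OF inj]) (simp add: o_def)
  also have "\<dots> = (\<Sum>\<^sub>\<infinity>F\<in>confs S (c - site_charge k). q powr \<bar>of_int k + 1/2\<bar> * ?f F)"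
  proof (rule infsum_cong)
    fix F assume "F \<in> confs S (c - site_charge k)"
    hence "finite F" "k \<notin> F" using k by (auto simp: confs_def)
    thus "?f (insert k F) = q powr \<bar>of_int k + 1/2\<bar> * ?f F" by (simp add: powr_add)
  qed
  also have "\<dots> = q powr \<bar>of_int k + 1/2\<bar> * Z q S (c - site_charge k)"
    unfolding Z_def by (rule infsum_cmult_right')
  finally show ?thesis
    unfolding Z_def split using infsum_Un_disjoint[OF confs_summable[OF q] sm disj] by (simp add: Z_def)
qed

section \<open>Translation of the Maya diagram\<close>

lemma mem_translate: "(k :: int) \<in> (\<lambda>k. k + 1) ` G \<longleftrightarrow> k - 1 \<in> G"
  and mem_translate': "(k :: int) \<in> (\<lambda>k. k - 1) ` G \<longleftrightarrow> k + 1 \<in> G"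
  by force+

text \<open>The Maya diagram of \<open>F\<close> is its symmetric difference with the negative
  sites. When that diagram moves up by one, the translated negative sites contain 0 in addition, so
  \<open>F\<close> is translated and membership of 0 is negated.\<close>

definition raise_charge :: "int set \<Rightarrow> int set" where
  "raise_charge F = (if - 1 \<in> F then (\<lambda>k. k + 1) ` (F - {- 1}) else insert 0 ((\<lambda>k. k + 1) ` F))"

definition lower_charge :: "int set \<Rightarrow> int set" where
  "lower_charge F = (if 0 \<in> F then (\<lambda>k. k - 1) ` (F - {0}) else insert (- 1) ((\<lambda>k. k - 1) ` F))"

lemma charge_translate:
  assumes "- 1 \<notin> F"
  shows "charge ((\<lambda>k. k + 1) ` F) = charge F"
proof -
  have "charge ((\<lambda>k. k + 1) ` F) = (\<Sum>k\<in>F. site_charge (k + 1))"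
    unfolding charge_def by (subst sum.reindex) (auto simp: inj_on_def)
  also have "\<dots> = charge F"
    unfolding charge_def
  proof (rule sum.cong)
    fix k assume "k \<in> F"
    hence "k \<noteq> - 1" using assms by auto
    thus "site_charge (k + 1) = site_charge k" by (auto simp: site_charge_def)
  qed simp
  finally show ?thesis .
qed

text \<open>A positive site moves away from the origin and gains energy 1, a negative one loses 1,
  so the total gain is the charge. Site -1 would cross the origin and is treated separately.\<close>

lemma energy_translate:
  assumes "- 1 \<notin> F"
  shows "energy ((\<lambda>k. k + 1) ` F) = energy F + of_int (charge F)"
proof -
  have "energy ((\<lambda>k. k + 1) ` F) = (\<Sum>k\<in>F. \<bar>of_int (k + 1) + 1/2\<bar>)"
    unfolding energy_def by (subst sum.reindex) (auto simp: inj_on_def)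
  also have "\<dots> = (\<Sum>k\<in>F. \<bar>of_int k + 1/2\<bar> + real_of_int (site_charge k))"
  proof (rule sum.cong)
    fix k assume "k \<in> F"
    hence "k \<le> - 2 \<or> 0 \<le> k" using assms by (cases "k = - 1") auto
    thus "\<bar>of_int (k + 1) + 1/2\<bar> = \<bar>of_int k + 1/2\<bar> + real_of_int (site_charge k)"
      by (auto simp: site_charge_def)
  qed simp
  finally show ?thesis by (simp add: energy_def charge_def sum.distrib)
qed

lemma charge_raise: "finite F \<Longrightarrow> charge (raise_charge F) = charge F + 1"
  and energy_raise: "finite F \<Longrightarrow> energy (raise_charge F) = energy F + of_int (charge F) + 1/2"
proof -
  assume fin: "finite F"
  have "charge (raise_charge F) = charge F + 1 \<and> energy (raise_charge F) = energy F + of_int (charge F) + 1/2"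
  proof (cases "- 1 \<in> F")
    case True
    then obtain G where G: "F = insert (- 1) G" "- 1 \<notin> G" by (meson Set.set_insert)
    moreover have "finite G" using fin G by auto
    ultimately show ?thesis
      by (simp add: raise_charge_def charge_translate energy_translate site_charge_def)
  next
    case False
    have "0 \<notin> (\<lambda>k. k + 1) ` F" using False by (simp add: mem_translate)
    thus ?thesis using False fin
      by (simp add: raise_charge_def charge_translate energy_translate site_charge_def)
  qed
  thus "charge (raise_charge F) = charge F + 1"
    and "energy (raise_charge F) = energy F + of_int (charge F) + 1/2" by auto
qed

lemma mem_raise: "k \<in> raise_charge F \<longleftrightarrow> (if k = 0 then - 1 \<notin> F else k - 1 \<in> F)"
  by (auto simp: raise_charge_def mem_translate)

lemma mem_lower: "k \<in> lower_charge F \<longleftrightarrow> (if k = - 1 then 0 \<notin> F else k + 1 \<in> F)"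
  by (auto simp: lower_charge_def mem_translate')

lemma raise_lower_charge: "raise_charge (lower_charge F) = F" "lower_charge (raise_charge F) = F"
  by (auto simp: mem_raise mem_lower split: if_splits)

lemma finite_raise_lower: "finite F \<Longrightarrow> finite (raise_charge F)" "finite F \<Longrightarrow> finite (lower_charge F)"
  by (auto simp: raise_charge_def lower_charge_def)

text \<open>On configurations of fixed charge \<open>c\<close>, \<open>raise_charge\<close> adds the
  constant \<open>c + 1/2\<close> to the energy, so the whole sum changes by one factor.\<close>

lemma Z_shift:
  assumes "0 < q"
  shows "Z q UNIV (c + 1) = q powr (of_int c + 1/2) * Z q UNIV c"
proof -
  have "bij_betw raise_charge (confs UNIV c) (confs UNIV (c + 1))"
  proof (rule bij_betw_byWitness[where f' = lower_charge])
    show "raise_charge ` confs UNIV c \<subseteq> confs UNIV (c + 1)"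
      by (auto simp: confs_def charge_raise finite_raise_lower)
    show "lower_charge ` confs UNIV (c + 1) \<subseteq> confs UNIV c"
    proof
      fix F assume "F \<in> lower_charge ` confs UNIV (c + 1)"
      then obtain G where G: "finite G" "charge G = c + 1" "F = lower_charge G" by (auto simp: confs_def)
      thus "F \<in> confs UNIV c"
        using charge_raise[of "lower_charge G"] by (simp add: confs_def raise_lower_charge finite_raise_lower)
    qed
  qed (auto simp: raise_lower_charge)
  hence "Z q UNIV (c + 1) = (\<Sum>\<^sub>\<infinity>F\<in>confs UNIV c. q powr energy (raise_charge F))"
    unfolding Z_def by (rule infsum_reindex_bij_betw[symmetric])
  also have "\<dots> = (\<Sum>\<^sub>\<infinity>F\<in>confs UNIV c. q powr (of_int c + 1/2) * q powr energy F)"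
    using assms by (intro infsum_cong)
      (auto simp: confs_def energy_raise powr_add[symmetric] add_ac)
  finally show ?thesis by (simp add: Z_def infsum_cmult_right')
qed

text \<open>The exponents \<open>c + 1/2\<close> telescope to \<open>c^2 / 2\<close>, in both
  directions from 0: the Gaussian weights of the triple product.\<close>

lemma Z_UNIV:
  assumes "0 < q"
  shows "Z q UNIV c = q powr (of_int c ^ 2 / 2) * Z q UNIV 0"
proof (induction c rule: int_induct[where k = 0])
  case (step1 c)
  have "real_of_int (c + 1) ^ 2 / 2 = (of_int c + 1/2) + of_int c ^ 2 / 2"
    by (simp add: power2_eq_square field_simps)
  thus ?case using step1 by (simp only: Z_shift[OF assms] powr_add mult.assoc)
next
  case (step2 c)
  have "q powr (of_int (c - 1) + 1/2) * Z q UNIV (c - 1) = Z q UNIV c"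
    using Z_shift[OF assms, of "c - 1"] by simp
  hence "Z q UNIV (c - 1) = q powr (- (of_int (c - 1) + 1/2)) * Z q UNIV c"
    using assms by (simp add: powr_minus field_simps)
  moreover have "real_of_int (c - 1) ^ 2 / 2 = - (of_int (c - 1) + 1/2) + of_int c ^ 2 / 2"
    by (simp add: power2_eq_square field_simps)
  ultimately show ?case using step2 by (simp only: powr_add mult.assoc)
qed (use assms in simp)

section \<open>Log-concavity in the charge and removal of sites\<close>

text \<open>Two indices are used because \<open>Z q S\<close> has zeros for finite \<open>S\<close>.
  The case \<open>i = j\<close> alone admits internal gaps and is then not preserved by
  convolution.\<close>

definition log_concave :: "(int \<Rightarrow> real) \<Rightarrow> bool" where
  "log_concave a \<longleftrightarrow> (\<forall>i j. i \<le> j \<longrightarrow> a (i - 1) * a (j + 1) \<le> a i * a j)"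

lemma log_concaveD: "log_concave a \<Longrightarrow> i \<le> j \<Longrightarrow> a (i - 1) * a (j + 1) \<le> a i * a j"
  by (simp add: log_concave_def)

lemma log_concave_translate:
  assumes "log_concave a"
  shows "log_concave (\<lambda>c. a (c + d))"
  unfolding log_concave_def
proof (intro allI impI)
  fix i j :: int assume "i \<le> j"
  thus "a (i - 1 + d) * a (j + 1 + d) \<le> a (i + d) * a (j + d)"
    using log_concaveD[OF assms, of "i + d" "j + d"] by (simp add: algebra_simps)
qed

text \<open>The difference of the two sides is a combination of three differences of products of
  \<open>a\<close>, with coefficients \<open>u * u\<close>, \<open>v * v\<close> and
  \<open>u * v\<close>.\<close>

lemma log_concave_convolve:
  assumes a: "log_concave a" and uv: "0 \<le> u" "0 \<le> v"
  shows "log_concave (\<lambda>c. u * a c + v * a (c - 1))"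
  unfolding log_concave_def
proof (intro allI impI)
  fix i j :: int assume ij: "i \<le> j"
  have 1: "a (i - 1) * a (j + 1) \<le> a i * a j" by (rule log_concaveD[OF a ij])
  have 2: "a (i - 2) * a j \<le> a (i - 1) * a (j - 1)"
    using log_concaveD[OF a, of "i - 1" "j - 1"] ij by simp
  \<comment> \<open>Here the indices move inward by two, which takes two applications through
    \<open>a (i - 1) * a j\<close>. For \<open>i = j\<close> they cross, and a single application
    suffices by commutativity.\<close>
  have 3: "a (i - 2) * a (j + 1) \<le> a i * a (j - 1)"
  proof (cases "i = j")
    case True
    thus ?thesis using log_concaveD[OF a, of "i - 1" i] by (simp add: mult.commute)
  next
    case False
    hence "a (i - 1) * a j \<le> a i * a (j - 1)"
      using log_concaveD[OF a, of i "j - 1"] ij by simp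
    moreover have "a (i - 2) * a (j + 1) \<le> a (i - 1) * a j"
      using log_concaveD[OF a, of "i - 1" j] ij by simp
    ultimately show ?thesis by linarith
  qed
  have "0 \<le> u * u * (a i * a j - a (i - 1) * a (j + 1))
      + v * v * (a (i - 1) * a (j - 1) - a (i - 2) * a j)
      + u * v * (a i * a (j - 1) - a (i - 2) * a (j + 1))"
    using 1 2 3 uv by (intro add_nonneg_nonneg mult_nonneg_nonneg) auto
  thus "(u * a (i - 1) + v * a (i - 1 - 1)) * (u * a (j + 1) + v * a (j + 1 - 1))
      \<le> (u * a i + v * a (i - 1)) * (u * a j + v * a (j - 1))"
    by (simp add: algebra_simps)
qed

text \<open>The ratio bounded in \<open>le\<close> is a mediant of \<open>a (c + 1) / a c\<close>
  and \<open>a (c + 2) / a (c + 1)\<close>. The first of these is the larger, so a lower bound for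
  the mediant holds for it.\<close>

lemma log_concave_ratio_lower:
  fixes \<rho> :: real
  assumes a: "log_concave a" and pos: "\<And>c. 0 < a c" and uv: "0 < u" "0 < v"
    and le: "\<rho> * (u * a c + v * a (c + 1)) \<le> u * a (c + 1) + v * a (c + 2)"
  shows "\<rho> * a c \<le> a (c + 1)"
proof (rule ccontr)
  assume "\<not> ?thesis"
  hence lt: "a (c + 1) < \<rho> * a c" by simp
  have "a c * a (c + 2) \<le> a (c + 1) * a (c + 1)"
    using log_concaveD[OF a, of "c + 1" "c + 1"] by (simp add: add.commute)
  also have "\<dots> \<le> (\<rho> * a c) * a (c + 1)" using lt pos[of "c + 1"] by (intro mult_right_mono) auto
  finally have "a c * a (c + 2) \<le> a c * (\<rho> * a (c + 1))" by (simp add: mult_ac)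
  hence "a (c + 2) \<le> \<rho> * a (c + 1)" using pos[of c] by simp
  hence "v * a (c + 2) \<le> v * (\<rho> * a (c + 1))" using uv by simp
  moreover have "u * a (c + 1) < u * (\<rho> * a c)" using lt uv by simp
  ultimately show False using le by (simp add: algebra_simps)
qed

text \<open>Now the mediant is formed one index lower, of \<open>a c / a (c - 1)\<close> and
  \<open>a (c + 1) / a c\<close>. The second is the smaller, so it inherits an upper bound.\<close>

lemma log_concave_ratio_upper:
  fixes \<rho> :: real
  assumes a: "log_concave a" and pos: "\<And>c. 0 < a c" and uv: "0 < u" "0 < v"
    and le: "u * a c + v * a (c + 1) \<le> \<rho> * (u * a (c - 1) + v * a c)"
  shows "a (c + 1) \<le> \<rho> * a c"
proof (rule ccontr)
  assume "\<not> ?thesis"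
  hence lt: "\<rho> * a c < a (c + 1)" by simp
  have "a (c - 1) * (\<rho> * a c) \<le> a (c - 1) * a (c + 1)"
    using lt pos[of "c - 1"] by (intro mult_left_mono) auto
  also have "\<dots> \<le> a c * a c"
    using log_concaveD[OF a, of c c] by simp
  finally have "(\<rho> * a (c - 1)) * a c \<le> a c * a c" by (simp add: mult_ac)
  hence "\<rho> * a (c - 1) \<le> a c" using pos[of c] by simp
  hence "u * (\<rho> * a (c - 1)) \<le> u * a c" using uv by simp
  moreover have "v * (\<rho> * a c) < v * a (c + 1)" using lt uv by simp
  ultimately show False using le by (simp add: algebra_simps)
qed

lemma log_concave_Z_finite:
  assumes q: "0 < q" "q < 1" and "finite S"
  shows "log_concave (Z q S)"
  using \<open>finite S\<close>
proof (induction S rule: finite_induct)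
  case empty
  have "confs {} c = (if c = 0 then {{}} else {})" for c by (auto simp: confs_def)
  hence "Z q {} c = (if c = 0 then 1 else 0)" for c using q by (simp add: Z_def)
  thus ?case by (simp add: log_concave_def)
next
  case (insert k S)
  let ?y = "q powr \<bar>of_int k + 1/2\<bar>"
  show ?case
  proof (cases "0 \<le> k")
    case True
    hence "Z q (insert k S) = (\<lambda>c. 1 * Z q S c + ?y * Z q S (c - 1))"
      using Z_insert[OF q insert.hyps(2)] by (simp add: site_charge_def fun_eq_iff)
    thus ?thesis using log_concave_convolve[OF insert.IH, of 1 ?y] by simp
  next
    case False
    \<comment> \<open>A negative site also convolves with a two-point sequence, after a shift of the
      index by 1.\<close>
    hence "Z q (insert k S) = (\<lambda>c. ?y * Z q S (c + 1) + 1 * Z q S (c + 1 - 1))"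
      using Z_insert[OF q insert.hyps(2)] by (simp add: site_charge_def fun_eq_iff)
    thus ?thesis
      using log_concave_translate[OF log_concave_convolve[OF insert.IH, of ?y 1], of 1] by simp
  qed
qed

text \<open>The inequalities are closed under pointwise limits, and \<open>S\<close> is exhausted by
  its intersections with finite windows.\<close>

lemma log_concave_Z:
  assumes q: "0 < q" "q < 1"
  shows "log_concave (Z q S)"
proof -
  let ?S = "\<lambda>n :: nat. S \<inter> {- int n..int n}"
  have lim: "(\<lambda>n. Z q (?S n) c) \<longlonglongrightarrow> Z q S c" for c
  proof -
    have "confs S c \<subseteq> (\<Union>n. confs (?S n) c)"
    proof
      fix F assume F: "F \<in> confs S c"
      define n where "n = nat (\<Sum>k\<in>F. \<bar>k\<bar>)"
      have "k \<in> {- int n..int n}" if "k \<in> F" for k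
      proof -
        have "\<bar>k\<bar> \<le> (\<Sum>k\<in>F. \<bar>k\<bar>)"
          using F that by (intro member_le_sum) (auto simp: confs_def)
        thus ?thesis by (auto simp: n_def)
      qed
      hence "F \<in> confs (?S n) c" using F by (auto simp: confs_def)
      thus "F \<in> (\<Union>n. confs (?S n) c)" by blast
    qed
    hence U: "(\<Union>n. confs (?S n) c) = confs S c" by (auto simp: confs_def)
    have "incseq (\<lambda>n. confs (?S n) c)"
      by (force simp: incseq_def confs_def)
    from infsum_UNION_incseq_LIMSEQ[OF this, of "\<lambda>F. q powr energy F"]
    show ?thesis unfolding U Z_def using confs_summable[OF q] by simp
  qed
  show ?thesis
    unfolding log_concave_def
  proof (intro allI impI)
    fix i j :: int assume "i \<le> j"
    hence "Z q (?S n) (i - 1) * Z q (?S n) (j + 1) \<le> Z q (?S n) i * Z q (?S n) j" for n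
      using log_concaveD[OF log_concave_Z_finite[OF q, of "?S n"]] by simp
    thus "Z q S (i - 1) * Z q S (j + 1) \<le> Z q S i * Z q S j"
      by (intro LIMSEQ_le[OF tendsto_mult[OF lim lim] tendsto_mult[OF lim lim]]) blast
  qed
qed

section \<open>Removal of finitely many sites\<close>

lemma Z_pos:
  assumes q: "0 < q" "q < 1" and X: "finite X"
  shows "0 < Z q (- X) c"
proof -
  have "\<exists>F \<subseteq> - X. finite F \<and> charge F = c"
  proof (cases "0 \<le> c")
    case True
    have "infinite ({0..} - X)" using X by (simp add: infinite_Ici)
    then obtain F where F: "finite F" "card F = nat c" "F \<subseteq> {0..} - X"
      using infinite_arbitrarily_large by blast
    hence "charge F = (\<Sum>k\<in>F. 1)" unfolding charge_def by (intro sum.cong) (auto simp: site_charge_def)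
    thus ?thesis using F True by (intro exI[of _ F]) auto
  next
    case False
    have "infinite ({..- 1} - X)" using X by (simp add: infinite_Iic)
    then obtain F where F: "finite F" "card F = nat (- c)" "F \<subseteq> {..- 1} - X"
      using infinite_arbitrarily_large by blast
    hence "charge F = (\<Sum>k\<in>F. - 1)" unfolding charge_def by (intro sum.cong) (auto simp: site_charge_def)
    thus ?thesis using F False by (intro exI[of _ F]) auto
  qed
  then obtain F where F: "F \<in> confs (- X) c" by (auto simp: confs_def)
  have "0 < q powr energy F" using q by simp
  also have "\<dots> = sum (\<lambda>F. q powr energy F) {F}" by simp
  also have "\<dots> \<le> Z q (- X) c"
    unfolding Z_def using F by (intro finite_sum_le_infsum confs_summable q) auto
  finally show ?thesis .
qed

text \<open>Without removal the ratio is exactly \<open>q powr (c + 1/2)\<close>. Each removed site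
  is paid for by at most one more factor \<open>q\<close> in either direction, through the mediant
  lemmas.\<close>

lemma Z_ratio_bounds:
  assumes q: "0 < q" "q < 1" and X: "finite X"
  shows "q powr (of_int c + 1/2 + card X) * Z q (- X) c \<le> Z q (- X) (c + 1) \<and>
         Z q (- X) (c + 1) \<le> q powr (of_int c + 1/2 - card X) * Z q (- X) c"
  using X
proof (induction X arbitrary: c rule: finite_induct)
  case empty
  thus ?case using Z_shift[OF q(1)] by simp
next
  case (insert k X)
  let ?m = "real (card X)"
  define a where "a = Z q (- insert k X)"
  define y where "y = q powr \<bar>of_int k + 1/2\<bar>"
  have y: "0 < y" using q by (simp add: y_def)
  have lc: "log_concave a" unfolding a_def by (rule log_concave_Z[OF q])
  have pos: "0 < a c" for c unfolding a_def using q insert.hyps by (intro Z_pos) auto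
  have "insert k (- insert k X) = - X" using insert.hyps by auto
  hence A: "Z q (- X) c = a c + y * a (c - site_charge k)" for c
    using Z_insert[OF q, of k "- insert k X" c] by (simp add: a_def y_def)
  have card: "real (card (insert k X)) = ?m + 1" using insert.hyps by simp
  have q_le: "q powr s * a c \<le> q powr t * a c" if "t \<le> s" for s t
    using q that pos[of c] by (intro mult_right_mono powr_mono') auto
  have "q powr (of_int c + 1/2 + (?m + 1)) * a c \<le> a (c + 1) \<and>
        a (c + 1) \<le> q powr (of_int c + 1/2 - (?m + 1)) * a c"
  proof (cases "0 \<le> k")
    case True
    hence A: "Z q (- X) c = y * a (c - 1) + 1 * a c" for c using A by (simp add: site_charge_def)
    \<comment> \<open>For a positive site the lower bound comes from the ratio of
      \<open>Z q (- X)\<close> at \<open>c + 1\<close>, which costs the factor \<open>q\<close>; the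
      upper bound comes from the ratio at \<open>c\<close> and is merely weakened.\<close>
    have "q powr (of_int (c + 1) + 1/2 + ?m) * a c \<le> a (c + 1)"
      by (rule log_concave_ratio_lower[OF lc pos y zero_less_one])
        (use insert.IH[of "c + 1"] q in \<open>simp_all add: A add_ac\<close>)
    moreover have "a (c + 1) \<le> q powr (of_int c + 1/2 - ?m) * a c"
      by (rule log_concave_ratio_upper[OF lc pos y zero_less_one])
        (use insert.IH[of c] q in \<open>simp_all add: A\<close>)
    ultimately show ?thesis
      using q_le[of "of_int c + 1/2 - (?m + 1)" "of_int c + 1/2 - ?m"] by (auto simp: add_ac)
  next
    case False
    hence A: "Z q (- X) c = 1 * a c + y * a (c + 1)" for c using A by (simp add: site_charge_def)
    have "q powr (of_int c + 1/2 + ?m) * a c \<le> a (c + 1)"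
      by (rule log_concave_ratio_lower[OF lc pos zero_less_one y])
        (use insert.IH[of c] q in \<open>simp_all add: A add_ac\<close>)
    \<comment> \<open>For a negative site the roles are exchanged: the upper bound uses the ratio at
      \<open>c - 1\<close>.\<close>
    moreover have "a (c + 1) \<le> q powr (of_int (c - 1) + 1/2 - ?m) * a c"
      by (rule log_concave_ratio_upper[OF lc pos zero_less_one y])
        (use insert.IH[of "c - 1"] q in \<open>simp_all add: A\<close>)
    ultimately show ?thesis
      using q_le[of "of_int c + 1/2 + ?m" "of_int c + 1/2 + (?m + 1)"] by (auto simp: algebra_simps)
  qed
  thus ?case by (simp only: a_def card)
qed

text \<open>If neighbouring charges had equal weight, restoring the site \<open>k\<close> would
  multiply the sum by \<open>1 + y\<close>, as for an independent site. The ratio bounds make this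
  true up to \<open>q powr L\<close>.\<close>

lemma Z_remove_bounds:
  fixes m :: nat
  assumes q: "0 < q" "q < 1" and X: "finite X" and k: "k \<notin> X"
    and card: "card (insert k X) \<le> m" and c: "\<bar>c\<bar> \<le> int m"
  defines "y \<equiv> q powr \<bar>of_int k + 1/2\<bar>" and "L \<equiv> 2 * real m + 1"
  shows "q powr L * ((1 + y) * Z q (- insert k X) c) \<le> Z q (- X) c"
    and "q powr L * Z q (- X) c \<le> (1 + y) * Z q (- insert k X) c"
proof -
  define a where "a = Z q (- insert k X)"
  have pos: "0 < a c" for c unfolding a_def using q X by (intro Z_pos) auto
  have y: "0 < y" using q by (simp add: y_def)
  have "insert k (- insert k X) = - X" using k by auto
  hence A: "Z q (- X) c = a c + y * a (c - site_charge k)" for c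
    using Z_insert[OF q, of k "- insert k X" c] by (simp add: a_def y_def)
  \<comment> \<open>Only \<open>d = c\<close> and \<open>d = c - 1\<close> occur. The exponents in
    \<open>Z_ratio_bounds\<close> are then at most \<open>(m + 1/2) + m\<close> in absolute value,
    which is below \<open>L\<close>.\<close>
  have r: "q powr L * a d \<le> a (d + 1)" "q powr L * a (d + 1) \<le> a d"
    if "\<bar>of_int d + 1/2 :: real\<bar> \<le> real m + 1/2" for d
  proof -
    let ?n = "real (card (insert k X))"
    have n: "?n \<le> real m" using card by simp
    have "q powr L * a d \<le> q powr (of_int d + 1/2 + ?n) * a d"
      using q n that pos[of d] by (intro mult_right_mono powr_mono') (auto simp: L_def)
    also have "\<dots> \<le> a (d + 1)"
      using Z_ratio_bounds[OF q, of "insert k X" d] X unfolding a_def by blast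
    finally show "q powr L * a d \<le> a (d + 1)" .
    have "q powr L * a (d + 1) \<le> q powr (- (of_int d + 1/2 - ?n)) * a (d + 1)"
      using q n that pos[of "d + 1"] by (intro mult_right_mono powr_mono') (auto simp: L_def)
    also have "\<dots> \<le> q powr (- (of_int d + 1/2 - ?n)) * (q powr (of_int d + 1/2 - ?n) * a d)"
      using Z_ratio_bounds[OF q, of "insert k X" d] X unfolding a_def by (intro mult_left_mono) auto
    also have "\<dots> = a d"
      using q by (simp only: mult.assoc[symmetric] powr_add[symmetric]) simp
    finally show "q powr L * a (d + 1) \<le> a d" .
  qed
  have b: "\<bar>of_int c :: real\<bar> \<le> real m" using c by linarith
  have R: "q powr L * a c \<le> a (c - site_charge k)" "q powr L * a (c - site_charge k) \<le> a c"
    using r[of c] r[of "c - 1"] b by (auto simp: site_charge_def)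
  have qL: "q powr L * t \<le> t" if "0 \<le> t" for t
    using q that by (intro mult_left_le_one_le) (auto simp: L_def powr_le1)
  show "q powr L * ((1 + y) * Z q (- insert k X) c) \<le> Z q (- X) c"
    unfolding A a_def[symmetric] using add_mono[OF qL[of "a c"] mult_left_mono[OF R(1), of y]] pos[of c] y
    by (simp add: algebra_simps)
  show "q powr L * Z q (- X) c \<le> (1 + y) * Z q (- insert k X) c"
    unfolding A a_def[symmetric] using add_mono[OF qL[of "a c"] mult_left_mono[OF R(2), of y]] pos[of c] y
    by (simp add: algebra_simps)
qed

text \<open>The sites are removed one at a time. The bound \<open>m\<close> is kept apart from
  \<open>card X\<close>, so that the same exponent \<open>2 * m + 1\<close> serves every step of the
  induction.\<close>

lemma Z_remove_all_bounds:
  fixes m :: nat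
  assumes q: "0 < q" "q < 1" and X: "finite X" and card: "card X \<le> m" and c: "\<bar>c\<bar> \<le> int m"
  defines "P \<equiv> \<Prod>k\<in>X. 1 + q powr \<bar>of_int k + 1/2\<bar>" and "L \<equiv> (2 * real m + 1) * card X"
  shows "q powr L * (P * Z q (- X) c) \<le> Z q UNIV c"
    and "q powr L * Z q UNIV c \<le> P * Z q (- X) c"
proof -
  let ?P = "\<lambda>X. \<Prod>k\<in>X. 1 + q powr \<bar>of_int k + 1/2\<bar>"
  let ?L = "\<lambda>X :: int set. (2 * real m + 1) * card X"
  have "q powr ?L X * (?P X * Z q (- X) c) \<le> Z q UNIV c \<and>
        q powr ?L X * Z q UNIV c \<le> ?P X * Z q (- X) c"
    using X card
  proof (induction X rule: finite_induct)
    case empty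
    show ?case using q by simp
  next
    case (insert k X)
    let ?y = "q powr \<bar>of_int k + 1/2\<bar>" and ?M = "2 * real m + 1"
    have IH: "q powr ?L X * (?P X * Z q (- X) c) \<le> Z q UNIV c"
        "q powr ?L X * Z q UNIV c \<le> ?P X * Z q (- X) c"
      using insert by auto
    have P: "0 \<le> ?P X" by (intro prod_nonneg) (simp add: add_nonneg_nonneg)
    have L: "q powr ?L (insert k X) = q powr ?L X * q powr ?M"
      using insert.hyps by (simp add: powr_add[symmetric] algebra_simps)
    note step = Z_remove_bounds[OF q insert.hyps(1,2) insert.prems c]
    have "q powr ?L (insert k X) * (?P (insert k X) * Z q (- insert k X) c) =
        (q powr ?L X * ?P X) * (q powr ?M * ((1 + ?y) * Z q (- insert k X) c))"
      unfolding L using insert.hyps by simp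
    also have "\<dots> \<le> (q powr ?L X * ?P X) * Z q (- X) c"
      using step(1) P by (intro mult_left_mono mult_nonneg_nonneg) auto
    also have "\<dots> \<le> Z q UNIV c" using IH(1) by (simp add: mult.assoc)
    finally have *: "q powr ?L (insert k X) * (?P (insert k X) * Z q (- insert k X) c) \<le> Z q UNIV c" .
    have "q powr ?L (insert k X) * Z q UNIV c = q powr ?M * (q powr ?L X * Z q UNIV c)"
      unfolding L by simp
    also have "\<dots> \<le> q powr ?M * (?P X * Z q (- X) c)"
      using IH(2) by (intro mult_left_mono) auto
    also have "\<dots> = ?P X * (q powr ?M * Z q (- X) c)" by simp
    also have "\<dots> \<le> ?P X * ((1 + ?y) * Z q (- insert k X) c)"
      using step(2) P by (intro mult_left_mono) auto
    also have "\<dots> = ?P (insert k X) * Z q (- insert k X) c" using insert.hyps by simp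
    finally show ?case using * by blast
  qed
  thus "q powr L * (P * Z q (- X) c) \<le> Z q UNIV c" "q powr L * Z q UNIV c \<le> P * Z q (- X) c"
    unfolding P_def L_def by blast+
qed

text \<open>\<open>R\<close> will turn out to be the correlation function, and \<open>P\<close> is
  the product of the independent occupation probabilities. In \<open>K\<close> the first summand
  pays for removing \<open>m\<close> sites, the second for passing from charge
  \<open>- charge X\<close> to charge 0.\<close>

lemma gibbs_ratio_bounds:
  fixes m :: nat
  assumes q: "0 < q" "q < 1" and X: "finite X" and card: "card X = m"
  defines "P \<equiv> \<Prod>k\<in>X. inverse (1 + q powr (- \<bar>of_int k + 1/2\<bar>))"
    and "R \<equiv> q powr energy X * Z q (- X) (- charge X) / Z q UNIV 0"
    and "K \<equiv> (2 * real m + 1) * m + real m ^ 2 / 2"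
  shows "q powr K * P \<le> R" and "q powr K * R \<le> P"
proof -
  let ?D = "\<Prod>k\<in>X. 1 + q powr \<bar>of_int k + 1/2\<bar>" and ?c = "- charge X"
  let ?L = "(2 * real m + 1) * m"
  define z0 where "z0 = Z q UNIV 0"
  define zX where "zX = Z q (- X) ?c"
  have z: "0 < z0" "0 < zX"
    using Z_pos[OF q, of "{}" 0] Z_pos[OF q X] by (simp_all add: z0_def zX_def)
  have D: "0 < ?D" by (intro prod_pos) (simp add: add_pos_nonneg)
  have absc: "\<bar>?c\<bar> \<le> int m" using abs_charge_le[of X] card by simp
  have "P = (\<Prod>k\<in>X. q powr \<bar>of_int k + 1/2\<bar> / (1 + q powr \<bar>of_int k + 1/2\<bar>))"
    unfolding P_def
  proof (rule prod.cong)
    fix k :: int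
    have "0 < 1 + q powr \<bar>of_int k + 1/2\<bar>" by (simp add: add_pos_nonneg)
    thus "inverse (1 + q powr (- \<bar>of_int k + 1/2\<bar>)) =
        q powr \<bar>of_int k + 1/2\<bar> / (1 + q powr \<bar>of_int k + 1/2\<bar>)"
      using q by (simp add: powr_minus field_simps)
  qed simp
  also have "\<dots> = q powr energy X / ?D"
    using q X by (simp add: prod_dividef energy_def powr_sum)
  finally have P: "P = q powr energy X / ?D" .
  have zc: "Z q UNIV ?c = q powr (of_int ?c ^ 2 / 2) * z0"
    unfolding z0_def by (rule Z_UNIV[OF q(1)])
  have "\<bar>real_of_int ?c\<bar> \<le> real m" using absc by linarith
  hence c2: "real_of_int ?c ^ 2 \<le> real m ^ 2"
    by (metis abs_ge_zero power2_abs power_mono)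
  note b = Z_remove_all_bounds[OF q X eq_refl[OF card] absc, unfolded card, folded zX_def]
  have "q powr K * z0 = q powr ?L * (q powr (real m ^ 2 / 2) * z0)"
    by (simp add: K_def powr_add)
  also have "\<dots> \<le> q powr ?L * Z q UNIV ?c"
    unfolding zc using q c2 z by (intro mult_left_mono mult_right_mono powr_mono') auto
  also have "\<dots> \<le> ?D * zX" by (rule b(2))
  finally have 1: "q powr K * z0 \<le> ?D * zX" .
  have "q powr K * (?D * zX) \<le> q powr ?L * (?D * zX)"
    using q D z by (intro mult_right_mono powr_mono') (auto simp: K_def)
  also have "\<dots> \<le> Z q UNIV ?c" by (rule b(1))
  \<comment> \<open>Charge 0 has the largest weight, so in this direction the change of charge costs
    nothing.\<close>
  also have "\<dots> \<le> 1 * z0"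
    unfolding zc using q z by (intro mult_right_mono powr_le1) auto
  finally have 2: "q powr K * (?D * zX) \<le> z0" by simp
  have "q powr K * P = q powr energy X * (q powr K * z0) / (?D * z0)"
    using z D by (simp add: P field_simps)
  also have "\<dots> \<le> q powr energy X * (?D * zX) / (?D * z0)"
    using 1 z D by (intro divide_right_mono mult_left_mono) auto
  also have "\<dots> = R" using z D by (simp add: R_def z0_def zX_def field_simps)
  finally show "q powr K * P \<le> R" .
  have "q powr K * R = q powr energy X * (q powr K * (?D * zX)) / (?D * z0)"
    using z D by (simp add: R_def z0_def[symmetric] zX_def[symmetric] field_simps)
  also have "\<dots> \<le> q powr energy X * z0 / (?D * z0)"
    using 2 z D by (intro divide_right_mono mult_left_mono) auto
  also have "\<dots> = P" using z D by (simp add: P field_simps)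
  finally show "q powr K * R \<le> P" .
qed

section \<open>Frobenius coordinates\<close>

text \<open>The integer standing for the half-integer \<open>lam i - Suc i + 1/2\<close> of
  \<open>maya\<close>; the sequence is strictly decreasing for a partition.\<close>

definition maya_seq :: "(nat \<Rightarrow> nat) \<Rightarrow> nat \<Rightarrow> int" where
  "maya_seq lam i = int (lam i) - int i - 1"

definition frob :: "(nat \<Rightarrow> nat) \<Rightarrow> int set" where
  "frob lam = {k. (k \<in> range (maya_seq lam)) \<noteq> (k < 0)}"

lemma Fr_eq: "Fr lam = (\<lambda>k::int. of_int k + 1/2) ` frob lam"
proof -
  let ?h = "\<lambda>k::int. of_int k + 1/2 :: real"
  have inj: "inj ?h" by (auto simp: inj_on_def)
  have "real (lam i) - real (Suc i) + 1/2 = ?h (maya_seq lam i)" for i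
    by (simp add: maya_seq_def)
  hence m: "maya lam = ?h ` range (maya_seq lam)"
    by (simp only: maya_def image_image)
  have "- (real k + 1/2) = ?h (- int k - 1)" for k by simp
  hence "neg_half_ints = ?h ` range (\<lambda>k::nat. - int k - 1)"
    by (simp only: neg_half_ints_def image_image)
  also have "range (\<lambda>k::nat. - int k - 1) = {k. k < 0}"
  proof -
    have "k = - int (nat (- k - 1)) - 1" if "k < 0" for k using that by simp
    hence "k \<in> range (\<lambda>k::nat. - int k - 1)" if "k < 0" for k using that by blast
    thus ?thesis by auto
  qed
  finally have n: "neg_half_ints = ?h ` {k. k < 0}" .
  have "frob lam = (range (maya_seq lam) - {k. k < 0}) \<union> ({k. k < 0} - range (maya_seq lam))"
    by (auto simp: frob_def)
  thus ?thesis
    unfolding Fr_def maya_pos_def maya_neg_def m n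
    by (simp only: image_Un image_set_diff[OF inj])
qed

lemma partitions_cutoff:
  assumes "lam \<in> partitions"
  obtains n where "\<And>i. n \<le> i \<Longrightarrow> lam i = 0"
proof -
  from assms have "finite {i. lam i \<noteq> 0}" by (simp add: partitions_def)
  then obtain n where "{i. lam i \<noteq> 0} \<subseteq> {..<n}" using finite_nat_bounded by blast
  hence "lam i = 0" if "n \<le> i" for i using that by (auto simp: subset_iff)
  thus ?thesis using that by blast
qed

lemma psize_eq:
  assumes "\<And>i. n \<le> i \<Longrightarrow> lam i = 0"
  shows "psize lam = (\<Sum>i<n. lam i)"
proof -
  have "{i. lam i \<noteq> 0} \<subseteq> {..<n}" using assms by (metis (mono_tags) lessThan_iff mem_Collect_eq not_le subsetI)
  thus ?thesis unfolding psize_def by (intro sum.mono_neutral_left) auto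
qed

lemma maya_seq_strict:
  assumes "antimono lam" "i < j"
  shows "maya_seq lam j < maya_seq lam i"
  using antimonoD[OF assms(1), of i j] assms(2) by (simp add: maya_seq_def)

text \<open>A signed sum over the Frobenius coordinates compares the Maya diagram with that of the
  empty partition. A general \<open>v\<close> treats charge and energy at once.\<close>

lemma sum_frob:
  fixes v :: "int \<Rightarrow> 'a :: comm_ring_1"
  assumes lam: "antimono lam" and n: "\<And>i. n \<le> i \<Longrightarrow> lam i = 0"
  shows "finite (frob lam)"
    and "(\<Sum>k\<in>frob lam. of_int (site_charge k) * v k) = (\<Sum>i<n. v (maya_seq lam i) - v (- int i - 1))"
proof -
  let ?B = "maya_seq lam ` {..<n}" and ?N = "(\<lambda>i. - int i - 1) ` {..<n}"
  have B: "- int n \<le> k" if "k \<in> ?B" for k using that by (auto simp: maya_seq_def)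
  have tail: "k \<in> range (maya_seq lam)" if "k < - int n" for k
  proof -
    have "k = maya_seq lam (nat (- k - 1))" using that n[of "nat (- k - 1)"] by (simp add: maya_seq_def)
    thus ?thesis by blast
  qed
  \<comment> \<open>Below \<open>- n\<close> the diagram and the negative sites agree, so only the
    first \<open>n\<close> entries \<open>?B\<close> and the \<open>n\<close> highest negative sites
    \<open>?N\<close> matter. Their common part cancels in the sum.\<close>
  have "range (maya_seq lam) = ?B \<union> {..< - int n}"
  proof
    show "range (maya_seq lam) \<subseteq> ?B \<union> {..< - int n}"
    proof
      fix k assume "k \<in> range (maya_seq lam)"
      then obtain i where "k = maya_seq lam i" by blast
      thus "k \<in> ?B \<union> {..< - int n}" using n[of i] by (cases "i < n") (auto simp: maya_seq_def)
    qed
  qed (use tail in auto)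
  moreover have "k \<in> ?N \<longleftrightarrow> - int n \<le> k \<and> k < 0" for k
  proof
    assume "- int n \<le> k \<and> k < 0"
    hence "k = - int (nat (- k - 1)) - 1" "nat (- k - 1) < n" by auto
    thus "k \<in> ?N" by blast
  qed auto
  ultimately have fr: "frob lam = (?B - ?N) \<union> (?N - ?B)"
    using B by (auto simp: frob_def)
  show "finite (frob lam)" by (simp add: fr)
  have pos: "0 \<le> k" if "k \<in> ?B - ?N" for k
    using that B[of k] \<open>\<And>k. k \<in> ?N \<longleftrightarrow> - int n \<le> k \<and> k < 0\<close>[of k] by auto
  have "(\<Sum>k\<in>frob lam. of_int (site_charge k) * v k) =
      (\<Sum>k\<in>?B - ?N. of_int (site_charge k) * v k) + (\<Sum>k\<in>?N - ?B. of_int (site_charge k) * v k)"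
    unfolding fr by (intro sum.union_disjoint) auto
  also have "(\<Sum>k\<in>?B - ?N. of_int (site_charge k) * v k) = (\<Sum>k\<in>?B - ?N. v k)"
    using pos by (intro sum.cong) (auto simp: site_charge_def)
  also have "(\<Sum>k\<in>?N - ?B. of_int (site_charge k) * v k) = (\<Sum>k\<in>?N - ?B. - v k)"
    by (intro sum.cong) (auto simp: site_charge_def)
  also have "(\<Sum>k\<in>?B - ?N. v k) + (\<Sum>k\<in>?N - ?B. - v k) = sum v ?B - sum v ?N"
    using sum.Int_Diff[of ?B v ?N] sum.Int_Diff[of ?N v ?B] by (simp add: sum_negf Int_commute)
  also have "sum v ?B = (\<Sum>i<n. v (maya_seq lam i))"
    using maya_seq_strict[OF lam]
    by (subst sum.reindex) (auto simp: inj_on_def, metis linorder_neqE_nat order_less_irrefl)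
  also have "sum v ?N = (\<Sum>i<n. v (- int i - 1))"
    by (subst sum.reindex) (auto simp: inj_on_def)
  finally show "(\<Sum>k\<in>frob lam. of_int (site_charge k) * v k) = (\<Sum>i<n. v (maya_seq lam i) - v (- int i - 1))"
    by (simp add: sum_subtractf)
qed

text \<open>\<open>sum_frob\<close> with \<open>v = 1\<close> gives the charge. With
  \<open>v k = k + 1/2\<close> it gives the energy, each row contributing
  \<open>maya_seq lam i - (- i - 1) = lam i\<close>.\<close>

lemma frob_in_confs:
  assumes "lam \<in> partitions"
  shows "frob lam \<in> confs UNIV 0" and "energy (frob lam) = psize lam"
proof -
  obtain n where n: "\<And>i. n \<le> i \<Longrightarrow> lam i = 0" using partitions_cutoff[OF assms] by blast
  have lam: "antimono lam" using assms by (simp add: partitions_def)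
  have "charge (frob lam) = 0"
    using sum_frob(2)[OF lam n, of n "\<lambda>_. 1 :: int"] by (simp add: charge_def)
  thus "frob lam \<in> confs UNIV 0" using sum_frob(1)[OF lam n] by (simp add: confs_def)
  have "energy (frob lam) = (\<Sum>k\<in>frob lam. of_int (site_charge k) * (of_int k + 1/2))"
    unfolding energy_def by (intro sum.cong) (auto simp: site_charge_def)
  also have "\<dots> = (\<Sum>i<n. real (lam i))"
    unfolding sum_frob(2)[OF lam n, of n, simplified] by (intro sum.cong) (auto simp: maya_seq_def)
  finally show "energy (frob lam) = psize lam" by (simp add: psize_eq[OF n])
qed

text \<open>By induction: \<open>u n\<close> equals some \<open>v j\<close>, and
  \<open>j < n\<close> is impossible because those values are already taken by earlier terms of
  \<open>u\<close>. Hence \<open>u n \<le> v n\<close>, and symmetrically.\<close>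

lemma strict_decreasing_range_eq:
  fixes f g :: "nat \<Rightarrow> 'a :: linorder"
  assumes f: "\<And>i j. i < j \<Longrightarrow> f j < f i" and g: "\<And>i j. i < j \<Longrightarrow> g j < g i"
    and eq: "range f = range g"
  shows "f = g"
proof
  fix n
  show "f n = g n"
  proof (induction n rule: less_induct)
    case (less n)
    have le: "u n \<le> v n" if u: "\<And>i j. i < j \<Longrightarrow> u j < u i" and v: "\<And>i j. i < j \<Longrightarrow> v j < v i"
      and "range u = range v" and IH: "\<And>i. i < n \<Longrightarrow> u i = v i" for u v :: "nat \<Rightarrow> 'a"
    proof -
      obtain j where j: "u n = v j" using \<open>range u = range v\<close> by (metis rangeE rangeI)
      have "n \<le> j" using u[of j n] IH[of j] j by (cases "j < n") auto
      thus ?thesis using v[of n j] j by (cases "n = j") auto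
    qed
    show ?case
    proof (rule antisym)
      show "f n \<le> g n" by (rule le) (use f g eq less in auto)
      show "g n \<le> f n" by (rule le) (use f g eq less in auto)
    qed
  qed
qed

lemma inj_on_frob: "inj_on frob partitions"
proof (rule inj_onI)
  fix lam mu assume *: "lam \<in> partitions" "mu \<in> partitions" and eq: "frob lam = frob mu"
  have "k \<in> range (maya_seq lam) \<longleftrightarrow> k \<in> range (maya_seq mu)" for k
    using eq by (auto simp: frob_def set_eq_iff)
  hence "range (maya_seq lam) = range (maya_seq mu)" by blast
  hence "maya_seq lam = maya_seq mu"
    using * by (intro strict_decreasing_range_eq) (auto simp: partitions_def maya_seq_strict)
  thus "lam = mu" by (auto simp: maya_seq_def fun_eq_iff)
qed

lemma frob_surj:
  assumes "F \<in> confs UNIV 0"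
  obtains lam where "lam \<in> partitions" "frob lam = F"
proof -
  have fin: "finite F" and ch: "charge F = 0" using assms by (auto simp: confs_def)
  \<comment> \<open>A crude bound: every site of \<open>F\<close> lies at or above
    \<open>- n\<close>. The set \<open>B\<close> below is the part of the Maya diagram from
    \<open>- n\<close> upward.\<close>
  define n where "n = nat (\<Sum>k\<in>F. \<bar>k\<bar>)"
  have F: "- int n \<le> k" if "k \<in> F" for k
  proof -
    have "\<bar>k\<bar> \<le> (\<Sum>k\<in>F. \<bar>k\<bar>)" using fin that by (intro member_le_sum) auto
    thus ?thesis by (auto simp: n_def)
  qed
  define N where "N = {- int n..<0}"
  define B where "B = (F - N) \<union> (N - F)"
  have finN: "finite N" and finB: "finite B" by (simp_all add: N_def B_def fin)
  \<comment> \<open>Charge 0 balances the positive sites of \<open>F\<close> against the holes in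
    the window \<open>N\<close>, so \<open>B\<close> has exactly \<open>n\<close> elements and fills
    the first \<open>n\<close> rows.\<close>
  have "charge F = charge (F - N) + charge (F \<inter> N)"
    using charge_Un_disjoint[of "F - N" "F \<inter> N"] fin by (simp add: Un_Diff_Int Diff_Int_distrib2)
  also have "charge (F - N) = (\<Sum>k\<in>F - N. 1)"
    unfolding charge_def by (intro sum.cong) (use F in \<open>auto simp: site_charge_def N_def\<close>)
  also have "charge (F \<inter> N) = (\<Sum>k\<in>F \<inter> N. - 1)"
    unfolding charge_def by (intro sum.cong) (auto simp: site_charge_def N_def)
  finally have "card (F - N) = card (F \<inter> N)" using ch by simp
  moreover have "card B = card (F - N) + card (N - F)"
    unfolding B_def using fin finN by (intro card_Un_disjoint) auto
  moreover have "card N = card (N - F) + card (F \<inter> N)"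
    using card_Int_Diff[OF finN, of F] by (simp add: Int_commute)
  ultimately have "card B = n" by (simp add: N_def)
  then obtain xs where xs: "sorted_wrt (<) xs" "set xs = B" "length xs = n"
    using finite_set_strict_sorted[OF finB] by metis
  \<comment> \<open>The list \<open>xs\<close> is increasing and is therefore read backwards; the
    tail \<open>- i - 1\<close> encodes rows of length 0.\<close>
  define k where "k i = (if i < n then xs ! (n - 1 - i) else - int i - 1)" for i
  have B_ge: "- int n \<le> x" if "x \<in> B" for x using that F by (auto simp: B_def N_def)
  have range_k: "range k = B \<union> {..< - int n}"
  proof (intro set_eqI iffI)
    fix x assume "x \<in> B \<union> {..< - int n}"
    thus "x \<in> range k"
    proof
      assume "x \<in> B"
      then obtain i where "i < n" "x = xs ! i" using xs by (metis in_set_conv_nth)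
      hence "x = k (n - 1 - i)" by (simp add: k_def)
      thus ?thesis by blast
    next
      assume "x \<in> {..< - int n}"
      hence "x = k (nat (- x - 1))" by (auto simp: k_def)
      thus ?thesis by blast
    qed
  next
    fix x assume "x \<in> range k"
    then obtain i where "x = k i" by blast
    thus "x \<in> B \<union> {..< - int n}" using xs by (cases "i < n") (auto simp: k_def)
  qed
  have "k (Suc i) < k i" for i
  proof -
    consider "Suc i < n" | "Suc i = n" | "n \<le> i" by linarith
    thus ?thesis
    proof cases
      case 1
      thus ?thesis using sorted_wrt_nth_less[OF xs(1), of "n - 1 - Suc i" "n - 1 - i"] xs(3)
        by (simp add: k_def)
    next
      case 2
      hence "k i \<in> B" using xs by (auto simp: k_def)
      thus ?thesis using B_ge[of "k i"] 2 by (simp add: k_def)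
    qed (simp add: k_def)
  qed
  \<comment> \<open>Strict decrease of the integers \<open>k i\<close> is weak decrease of the row
    lengths \<open>k i + i + 1\<close>. These vanish from \<open>n\<close> on, hence are nonnegative
    throughout.\<close>
  hence "k (Suc i) + 1 \<le> k i" for i by (simp add: zless_imp_add1_zle)
  hence dec: "decseq (\<lambda>i. k i + int i + 1)"
    by (intro decseq_SucI) (simp add: algebra_simps)
  have nonneg: "0 \<le> k i + int i + 1" for i
    using decseqD[OF dec, of i "max i n"] by (simp add: k_def)
  define lam where "lam i = nat (k i + int i + 1)" for i
  have seq: "maya_seq lam = k" using nonneg by (auto simp: maya_seq_def lam_def fun_eq_iff)
  have "antimono lam"
    unfolding lam_def using dec by (auto simp: antimono_def intro: nat_mono)
  moreover have "{i. lam i \<noteq> 0} \<subseteq> {..<n}" by (auto simp: lam_def k_def split: if_splits)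
  ultimately have "lam \<in> partitions" by (auto simp: partitions_def intro: finite_subset)
  moreover have "frob lam = F"
    unfolding frob_def seq range_k using F by (force simp: B_def N_def)
  ultimately show ?thesis by (rule that)
qed

lemma bij_betw_frob: "bij_betw frob partitions (confs UNIV 0)"
  unfolding bij_betw_def using inj_on_frob frob_in_confs(1) by (auto elim: frob_surj)

section \<open>Euler's identity and the correlation function\<close>

lemma powr_energy_frob:
  "0 < q \<Longrightarrow> lam \<in> partitions \<Longrightarrow> q powr energy (frob lam) = q ^ psize lam"
  by (simp add: frob_in_confs(2) powr_realpow)

lemma partitions_summable:
  fixes q :: real
  assumes q: "0 < q" "q < 1" and "A \<subseteq> partitions"
  shows "(\<lambda>lam. q ^ psize lam) summable_on A"
proof (rule summable_on_subset_banach[OF _ \<open>A \<subseteq> partitions\<close>])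
  have "(\<lambda>lam. q powr energy (frob lam)) summable_on partitions"
    using confs_summable[OF q] by (subst summable_on_reindex_bij_betw[OF bij_betw_frob])
  thus "(\<lambda>lam. q ^ psize lam) summable_on partitions"
    by (rule summable_on_cong[THEN iffD1, rotated]) (simp add: powr_energy_frob q)
qed

section \<open>Partitions with a bounded number of rows\<close>

definition partitions_upto :: "nat \<Rightarrow> (nat \<Rightarrow> nat) set" where
  "partitions_upto n = {lam \<in> partitions. \<forall>i\<ge>n. lam i = 0}"

lemma partitions_uptoI: "antimono lam \<Longrightarrow> (\<And>i. n \<le> i \<Longrightarrow> lam i = 0) \<Longrightarrow> lam \<in> partitions_upto n"
proof -
  assume lam: "antimono lam" "\<And>i. n \<le> i \<Longrightarrow> lam i = 0"
  have "{i. lam i \<noteq> 0} \<subseteq> {..<n}" using lam(2) by (metis (mono_tags) lessThan_iff mem_Collect_eq not_le subsetI)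
  hence "finite {i. lam i \<noteq> 0}" by (rule finite_subset) simp
  thus ?thesis using lam by (simp add: partitions_upto_def partitions_def)
qed

lemma partitions_uptoD: "lam \<in> partitions_upto n \<Longrightarrow> antimono lam"
  "lam \<in> partitions_upto n \<Longrightarrow> n \<le> i \<Longrightarrow> lam i = 0"
  by (auto simp: partitions_upto_def partitions_def)

definition add_columns :: "nat \<Rightarrow> (nat \<Rightarrow> nat) \<times> nat \<Rightarrow> nat \<Rightarrow> nat" where
  "add_columns n = (\<lambda>(lam, j) i. if i < n then lam i + j else 0)"

text \<open>In a diagram with at most \<open>Suc n\<close> rows, the last row \<open>lam n\<close>
  counts the columns of full height. Deleting them leaves at most \<open>n\<close> rows.\<close>

lemma bij_betw_add_columns:
  "bij_betw (add_columns (Suc n)) (partitions_upto n \<times> UNIV) (partitions_upto (Suc n))"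
proof (rule bij_betw_byWitness[where f' = "\<lambda>lam. (\<lambda>i. lam i - lam n, lam n)"])
  show "\<forall>p\<in>partitions_upto n \<times> UNIV. (\<lambda>i. add_columns (Suc n) p i - add_columns (Suc n) p n,
      add_columns (Suc n) p n) = p"
    by (auto simp: add_columns_def fun_eq_iff partitions_uptoD(2))
  have "add_columns (Suc n) (\<lambda>i. lam i - lam n, lam n) i = lam i"
    if "lam \<in> partitions_upto (Suc n)" for lam i
    using antimonoD[OF partitions_uptoD(1)[OF that], of i n] partitions_uptoD(2)[OF that, of i]
    by (auto simp: add_columns_def)
  thus "\<forall>lam\<in>partitions_upto (Suc n). add_columns (Suc n) (\<lambda>i. lam i - lam n, lam n) = lam"
    by auto
  show "add_columns (Suc n) ` (partitions_upto n \<times> UNIV) \<subseteq> partitions_upto (Suc n)"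
  proof (clarify, rule partitions_uptoI)
    fix lam j assume "lam \<in> partitions_upto n"
    thus "antimono (add_columns (Suc n) (lam, j))"
      by (auto simp: add_columns_def antimono_def dest!: partitions_uptoD(1))
  qed (simp add: add_columns_def)
  show "(\<lambda>lam. (\<lambda>i. lam i - lam n, lam n)) ` partitions_upto (Suc n) \<subseteq> partitions_upto n \<times> UNIV"
  proof (rule image_subsetI)
    fix lam assume lam: "lam \<in> partitions_upto (Suc n)"
    show "(\<lambda>i. lam i - lam n, lam n) \<in> partitions_upto n \<times> UNIV"
    proof (intro SigmaI partitions_uptoI)
      show "antimono (\<lambda>i. lam i - lam n)"
        using partitions_uptoD(1)[OF lam] by (auto simp: antimono_def intro: diff_le_mono)
      show "lam i - lam n = 0" if "n \<le> i" for i
        using antimonoD[OF partitions_uptoD(1)[OF lam] that] by simp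
    qed simp
  qed
qed

lemma psize_add_columns:
  assumes "lam \<in> partitions_upto n"
  shows "psize (add_columns (Suc n) (lam, j)) = psize lam + Suc n * j"
proof -
  have "psize (add_columns (Suc n) (lam, j)) = (\<Sum>i<Suc n. add_columns (Suc n) (lam, j) i)"
    by (rule psize_eq) (simp add: add_columns_def)
  also have "\<dots> = (\<Sum>i<Suc n. lam i) + Suc n * j"
    by (simp add: add_columns_def sum.distrib)
  also have "(\<Sum>i<Suc n. lam i) = psize lam"
    using partitions_uptoD(2)[OF assms] by (intro psize_eq[symmetric]) simp
  finally show ?thesis .
qed

text \<open>The number of columns of height \<open>Suc n\<close> is free, which contributes a
  geometric series with ratio \<open>q ^ Suc n\<close> at each step.\<close>

lemma infsum_partitions_upto:
  fixes q :: real
  assumes q: "0 < q" "q < 1"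
  shows "(\<Prod>i<n. 1 - q ^ Suc i) * (\<Sum>\<^sub>\<infinity>lam\<in>partitions_upto n. q ^ psize lam) = 1"
proof (induction n)
  case 0
  have "partitions_upto 0 = {\<lambda>_. 0}"
    by (auto simp: partitions_upto_def partitions_def antimono_def)
  thus ?case by (simp add: psize_def)
next
  case (Suc n)
  let ?f = "\<lambda>lam. q ^ psize lam" and ?r = "q ^ Suc n"
  have r: "0 \<le> ?r" "?r < 1" using q by (auto simp: power_less_one_iff simp del: power_Suc)
  have sm: "(\<lambda>p. ?f (add_columns (Suc n) p)) summable_on (partitions_upto n \<times> UNIV)"
    by (subst summable_on_reindex_bij_betw[OF bij_betw_add_columns])
      (intro partitions_summable q, auto simp: partitions_upto_def)
  have geo: "(\<Sum>\<^sub>\<infinity>j. ?r ^ j) = 1 / (1 - ?r)"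
  proof (rule infsumI)
    show "((\<lambda>j. ?r ^ j) has_sum 1 / (1 - ?r)) UNIV"
      using geometric_sums[of ?r] r by (intro sums_nonneg_imp_has_sum) auto
  qed
  have "infsum ?f (partitions_upto (Suc n)) =
      infsum (\<lambda>p. ?f (add_columns (Suc n) p)) (partitions_upto n \<times> UNIV)"
    by (rule infsum_reindex_bij_betw[OF bij_betw_add_columns, symmetric])
  also have "\<dots> = (\<Sum>\<^sub>\<infinity>lam\<in>partitions_upto n. \<Sum>\<^sub>\<infinity>j. ?f (add_columns (Suc n) (lam, j)))"
    by (rule infsum_Sigma_banach[OF sm, symmetric])
  also have "\<dots> = (\<Sum>\<^sub>\<infinity>lam\<in>partitions_upto n. ?f lam * (1 / (1 - ?r)))"
  proof (rule infsum_cong)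
    fix lam assume "lam \<in> partitions_upto n"
    hence "?f (add_columns (Suc n) (lam, j)) = ?f lam * ?r ^ j" for j
      by (simp only: psize_add_columns power_add power_mult)
    thus "(\<Sum>\<^sub>\<infinity>j. ?f (add_columns (Suc n) (lam, j))) = ?f lam * (1 / (1 - ?r))"
      by (simp only: infsum_cmult_right' geo)
  qed
  also have "\<dots> = infsum ?f (partitions_upto n) * (1 / (1 - ?r))"
    by (rule infsum_cmult_left')
  finally have "(1 - ?r) * infsum ?f (partitions_upto (Suc n)) = infsum ?f (partitions_upto n)"
    using r by (simp del: power_Suc)
  thus ?case using Suc by (simp only: prod.lessThan_Suc mult.assoc)
qed

lemma qpoch_inf_LIMSEQ:
  fixes q :: real
  assumes q: "0 < q" "q < 1"
  shows "(\<lambda>n. \<Prod>i<n. 1 - q ^ Suc i) \<longlonglongrightarrow> qpoch_inf q"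
proof -
  \<comment> \<open>Convergence has to come first: only then is the infinite product in
    \<open>qpoch_inf\<close> the limit of its partial products.\<close>
  have "summable (\<lambda>i. norm ((1 - q ^ Suc i) - 1))"
    using q summable_mult[OF summable_geometric[of q], of q] by (simp add: abs_mult)
  hence "convergent_prod (\<lambda>i. 1 - q ^ Suc i)"
    by (intro abs_convergent_prod_imp_convergent_prod summable_imp_abs_convergent_prod)
  hence "(\<lambda>n. \<Prod>i\<le>n. 1 - q ^ Suc i) \<longlonglongrightarrow> qpoch_inf q"
    unfolding qpoch_inf_def by (rule convergent_prod_LIMSEQ)
  thus ?thesis
    by (subst filterlim_sequentially_Suc[symmetric]) (simp only: lessThan_Suc_atMost)
qed

lemma euler_partition_identity:
  fixes q :: real
  assumes q: "0 < q" "q < 1"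
  shows "qpoch_inf q * (\<Sum>\<^sub>\<infinity>lam\<in>partitions. q ^ psize lam) = 1"
proof -
  have U: "(\<Union>n. partitions_upto n) = partitions"
  proof
    show "partitions \<subseteq> (\<Union>n. partitions_upto n)"
    proof
      fix lam assume lam: "lam \<in> partitions"
      then obtain n where "\<And>i. n \<le> i \<Longrightarrow> lam i = 0" using partitions_cutoff by blast
      hence "lam \<in> partitions_upto n" using lam by (simp add: partitions_upto_def)
      thus "lam \<in> (\<Union>n. partitions_upto n)" by blast
    qed
  qed (auto simp: partitions_upto_def)
  have "incseq partitions_upto" by (auto simp: incseq_def partitions_upto_def)
  hence "(\<lambda>n. infsum (\<lambda>lam. q ^ psize lam) (partitions_upto n))
      \<longlonglongrightarrow> infsum (\<lambda>lam. q ^ psize lam) partitions"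
    using infsum_UNION_incseq_LIMSEQ[of partitions_upto "\<lambda>lam. q ^ psize lam"]
      partitions_summable[OF q] q unfolding U by simp
  from tendsto_mult[OF qpoch_inf_LIMSEQ[OF q] this]
  have "(\<lambda>n. 1) \<longlonglongrightarrow> qpoch_inf q * (\<Sum>\<^sub>\<infinity>lam\<in>partitions. q ^ psize lam)"
    by (simp only: infsum_partitions_upto[OF q])
  thus ?thesis using LIMSEQ_unique tendsto_const by metis
qed

lemma qpoch_inf_nonneg: "0 < q \<Longrightarrow> q < 1 \<Longrightarrow> 0 \<le> qpoch_inf q"
  by (rule LIMSEQ_le_const[OF qpoch_inf_LIMSEQ])
    (auto intro!: exI[of _ 0] prod_nonneg simp: power_le_one simp del: power_Suc)

section \<open>The correlation function as a ratio of charge sums\<close>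

lemma corr_eq_infsum:
  assumes q: "0 < q" "q < 1"
  shows "corr X q = qpoch_inf q * (\<Sum>\<^sub>\<infinity>lam\<in>{lam\<in>partitions. X \<subseteq> Fr lam}. q ^ psize lam)"
proof -
  let ?B = "{lam\<in>partitions. X \<subseteq> Fr lam}"
  let ?f = "\<lambda>lam. qpoch_inf q * q ^ psize lam"
  let ?g = "\<lambda>lam. ?f lam * indicator ?B lam"
  have nn: "0 \<le> ?f lam" for lam using q qpoch_inf_nonneg[OF q] by simp
  have "?f summable_on ?B"
    by (intro summable_on_cmult_right partitions_summable q) auto
  \<comment> \<open>The measure has a density on \<open>count_space partitions\<close>, so the
    restriction to \<open>?B\<close> is carried by an indicator until the integral has become a
    sum.\<close>
  hence sm: "?g summable_on partitions"
    by (rule summable_on_cong_neutral[THEN iffD1, rotated -1]) auto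
  hence "(\<lambda>lam. norm (?g lam)) summable_on partitions" using nn
    by (simp only: real_norm_def abs_of_nonneg mult_nonneg_nonneg indicator_pos_le)
  hence abs: "Infinite_Set_Sum.abs_summable_on ?g partitions"
    using abs_summable_equivalent by blast
  have "emeasure (Mq q) ?B = (\<integral>\<^sup>+lam. ennreal (?f lam) * indicator ?B lam \<partial>count_space partitions)"
    unfolding Mq_def point_measure_def by (subst emeasure_density) auto
  also have "\<dots> = (\<integral>\<^sup>+lam. ennreal (?g lam) \<partial>count_space partitions)"
    by (intro nn_integral_cong) (auto simp: indicator_def)
  also have "\<dots> = ennreal (infsetsum ?g partitions)"
    using nn by (intro nn_integral_conv_infsetsum abs) simp
  also have "infsetsum ?g partitions = infsum ?g partitions"
    by (rule infsetsum_infsum[OF abs])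
  also have "infsum ?g partitions = infsum ?f ?B"
    by (rule infsum_cong_neutral) auto
  also have "\<dots> = qpoch_inf q * (\<Sum>\<^sub>\<infinity>lam\<in>?B. q ^ psize lam)"
    by (rule infsum_cmult_right')
  finally show ?thesis
    unfolding corr_def measure_def
    using qpoch_inf_nonneg[OF q] q by (simp add: infsum_nonneg)
qed

text \<open>Once \<open>X\<close> is occupied, the other sites are constrained only by having to
  carry the remaining charge.\<close>

lemma confs_supset:
  assumes X: "finite X"
  shows "bij_betw (\<lambda>G. G \<union> X) (confs (- X) (c - charge X)) {F \<in> confs UNIV c. X \<subseteq> F}"
proof (rule bij_betw_byWitness[where f' = "\<lambda>F. F - X"])
  show "(\<lambda>G. G \<union> X) ` confs (- X) (c - charge X) \<subseteq> {F \<in> confs UNIV c. X \<subseteq> F}"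
  proof
    fix F assume "F \<in> (\<lambda>G. G \<union> X) ` confs (- X) (c - charge X)"
    then obtain G where G: "finite G" "G \<inter> X = {}" "charge G = c - charge X" "F = G \<union> X"
      by (auto simp: confs_def)
    thus "F \<in> {F \<in> confs UNIV c. X \<subseteq> F}"
      using charge_Un_disjoint[OF G(1) X G(2)] X by (simp add: confs_def)
  qed
  show "(\<lambda>F. F - X) ` {F \<in> confs UNIV c. X \<subseteq> F} \<subseteq> confs (- X) (c - charge X)"
  proof
    fix G assume "G \<in> (\<lambda>F. F - X) ` {F \<in> confs UNIV c. X \<subseteq> F}"
    then obtain F where F: "finite F" "X \<subseteq> F" "charge F = c" "G = F - X"
      by (auto simp: confs_def)
    moreover have "charge (F - X \<union> X) = charge (F - X) + charge X"
      using F X by (intro charge_Un_disjoint) auto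
    moreover have "F - X \<union> X = F" using F by blast
    ultimately show "G \<in> confs (- X) (c - charge X)" by (auto simp: confs_def)
  qed
qed (auto simp: confs_def)

text \<open>Frobenius coordinates turn the sum over partitions into one over configurations
  containing \<open>X\<close>; Euler's identity shows that \<open>qpoch_inf q\<close> is
  \<open>1 / Z q UNIV 0\<close>.\<close>

lemma corr_eq_Z_ratio:
  fixes X :: "int set"
  assumes q: "0 < q" "q < 1" and X: "finite X"
  shows "corr ((\<lambda>k. of_int k + 1/2) ` X) q = q powr energy X * Z q (- X) (- charge X) / Z q UNIV 0"
proof -
  let ?h = "\<lambda>k::int. of_int k + 1/2 :: real"
  let ?B = "{lam \<in> partitions. ?h ` X \<subseteq> Fr lam}"
  have "inj ?h" by (auto simp: inj_on_def)
  hence B: "?B = {lam \<in> partitions. X \<subseteq> frob lam}"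
    by (simp add: Fr_eq inj_image_subset_iff)
  have bij: "bij_betw frob ?B {F \<in> confs UNIV 0. X \<subseteq> F}"
    unfolding B
  proof (rule bij_betw_subset[OF bij_betw_frob])
    show "frob ` {lam \<in> partitions. X \<subseteq> frob lam} = {F \<in> confs UNIV 0. X \<subseteq> F}"
      unfolding bij_betw_imp_surj_on[OF bij_betw_frob, symmetric] by blast
  qed auto
  have "(\<Sum>\<^sub>\<infinity>lam\<in>?B. q ^ psize lam) = (\<Sum>\<^sub>\<infinity>lam\<in>?B. q powr energy (frob lam))"
    by (rule infsum_cong) (simp add: powr_energy_frob q)
  also have "\<dots> = (\<Sum>\<^sub>\<infinity>F\<in>{F \<in> confs UNIV 0. X \<subseteq> F}. q powr energy F)"
    by (rule infsum_reindex_bij_betw[OF bij])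
  also have "\<dots> = (\<Sum>\<^sub>\<infinity>G\<in>confs (- X) (- charge X). q powr energy (G \<union> X))"
    using infsum_reindex_bij_betw[OF confs_supset[OF X, of 0], of "\<lambda>F. q powr energy F"] by simp
  also have "\<dots> = (\<Sum>\<^sub>\<infinity>G\<in>confs (- X) (- charge X). q powr energy X * q powr energy G)"
  proof (rule infsum_cong)
    fix G assume "G \<in> confs (- X) (- charge X)"
    hence "energy (G \<union> X) = energy G + energy X"
      using X by (intro energy_Un_disjoint) (auto simp: confs_def)
    thus "q powr energy (G \<union> X) = q powr energy X * q powr energy G"
      by (simp add: powr_add)
  qed
  also have "\<dots> = q powr energy X * Z q (- X) (- charge X)"
    unfolding Z_def by (rule infsum_cmult_right')
  finally have num: "(\<Sum>\<^sub>\<infinity>lam\<in>?B. q ^ psize lam) = q powr energy X * Z q (- X) (- charge X)" .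
  have "(\<Sum>\<^sub>\<infinity>lam\<in>partitions. q ^ psize lam) = (\<Sum>\<^sub>\<infinity>lam\<in>partitions. q powr energy (frob lam))"
    by (rule infsum_cong) (simp add: powr_energy_frob q)
  also have "\<dots> = Z q UNIV 0"
    unfolding Z_def by (rule infsum_reindex_bij_betw[OF bij_betw_frob])
  finally have "qpoch_inf q * Z q UNIV 0 = 1"
    using euler_partition_identity[OF q] by simp
  moreover have "0 < Z q UNIV 0" using Z_pos[OF q, of "{}"] by simp
  ultimately have "qpoch_inf q = 1 / Z q UNIV 0" by (simp add: field_simps)
  thus ?thesis unfolding corr_eq_infsum[OF q] num by simp
qed

section \<open>Asymptotics of the mean size\<close>

text \<open>Both series are the double sum of \<open>a * q^(a * b)\<close> over positive
  \<open>a\<close> and \<open>b\<close>: summed over \<open>a\<close> first it is the Lambert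
  series, grouped by the product \<open>a * b\<close> it has divisor sums as coefficients.\<close>

lemma mean_size_sums:
  fixes q :: real
  assumes q: "0 < q" "q < 1"
  shows "(\<lambda>b. q ^ Suc b / (1 - q ^ Suc b)\<^sup>2) sums mean_size q"
proof -
  define f where "f = (\<lambda>(a, b). real (Suc a) * q ^ (Suc a * Suc b))"
  have f_nonneg: "0 \<le> f p" for p using q by (auto simp: f_def split: prod.split)
  have qb: "0 \<le> q ^ Suc b" "q ^ Suc b < 1" for b
    using q by (auto simp: power_less_one_iff simp del: power_Suc)
  have row: "((\<lambda>a. f (a, b)) has_sum q ^ Suc b / (1 - q ^ Suc b)\<^sup>2) UNIV" for b
  proof (rule sums_nonneg_imp_has_sum)
    let ?z = "q ^ Suc b"
    have "(\<lambda>a. ?z * (of_nat (Suc a) * ?z ^ a)) sums (?z * (1 / (1 - ?z)\<^sup>2))"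
      using qb[of b] by (intro sums_mult geometric_deriv_sums) simp
    moreover have "?z * (of_nat (Suc a) * ?z ^ a) = f (a, b)" for a
    proof -
      have "q ^ (Suc a * Suc b) = ?z * ?z ^ a"
        by (simp only: power_mult[symmetric] power_add[symmetric]) (simp add: algebra_simps)
      thus ?thesis by (simp only: f_def prod.case mult_ac)
    qed
    ultimately show "(\<lambda>a. f (a, b)) sums (?z / (1 - ?z)\<^sup>2)" by simp
  qed (rule f_nonneg)
  have sm_rows: "summable (\<lambda>b. q ^ Suc b / (1 - q ^ Suc b)\<^sup>2)"
  proof (rule summable_comparison_test')
    show "summable (\<lambda>b. q / (1 - q)\<^sup>2 * q ^ b)" using q by (intro summable_mult summable_geometric) simp
    fix b
    have "q ^ Suc b \<le> q" using q by (simp add: mult_left_le power_le_one)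
    hence "(1 - q)\<^sup>2 \<le> (1 - q ^ Suc b)\<^sup>2" using q by (intro power_mono) auto
    hence "q ^ Suc b / (1 - q ^ Suc b)\<^sup>2 \<le> q ^ Suc b / (1 - q)\<^sup>2"
      using q qb[of b] by (intro divide_left_mono) auto
    thus "norm (q ^ Suc b / (1 - q ^ Suc b)\<^sup>2) \<le> q / (1 - q)\<^sup>2 * q ^ b"
      using qb[of b] by simp
  qed
  have rows: "((\<lambda>b. q ^ Suc b / (1 - q ^ Suc b)\<^sup>2) has_sum (\<Sum>b. q ^ Suc b / (1 - q ^ Suc b)\<^sup>2)) UNIV"
    using sm_rows qb by (intro sums_nonneg_imp_has_sum summable_sums) auto
  have sm': "(\<lambda>(b, a). f (a, b)) summable_on UNIV \<times> UNIV"
    by (rule summable_on_SigmaI[where g = "\<lambda>b. q ^ Suc b / (1 - q ^ Suc b)\<^sup>2"])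
      (use row rows f_nonneg in \<open>auto simp: summable_on_def\<close>)
  have tot: "infsum (\<lambda>(b, a). f (a, b)) (UNIV \<times> UNIV) = (\<Sum>b. q ^ Suc b / (1 - q ^ Suc b)\<^sup>2)"
    using infsum_Sigma_banach[OF sm'] infsumI[OF row] infsumI[OF rows] by simp
  let ?D = "SIGMA n:UNIV. {d. d dvd Suc n}"
  \<comment> \<open>\<open>(n, d)\<close> goes to \<open>(b, a)\<close> with
    \<open>Suc a = d\<close> and \<open>Suc a * Suc b = Suc n\<close>. Divisor and cofactor are
    positive, so the subtractions are exact.\<close>
  let ?j = "\<lambda>(n, d). (Suc n div d - 1, d - 1)"
  have bij: "bij_betw ?j ?D (UNIV \<times> UNIV)"
  proof (rule bij_betw_byWitness[where f' = "\<lambda>(b, a). (Suc a * Suc b - 1, Suc a)"])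
    show "\<forall>p\<in>?D. (\<lambda>(b, a). (Suc a * Suc b - 1, Suc a)) (?j p) = p"
    proof (rule ballI)
      fix p assume "p \<in> ?D"
      then obtain n d where p: "p = (n, d)" and "d dvd Suc n" by blast
      then obtain e where e: "Suc n = d * e" by (elim dvdE)
      hence "d > 0" "e > 0" by (auto intro: gr0I)
      moreover from this have "Suc n div d = e" using e by simp
      ultimately show "(\<lambda>(b, a). (Suc a * Suc b - 1, Suc a)) (?j p) = p"
        using e[symmetric] by (simp add: p del: mult_Suc mult_Suc_right)
    qed
    show "\<forall>p\<in>UNIV \<times> UNIV. ?j ((\<lambda>(b, a). (Suc a * Suc b - 1, Suc a)) p) = p"
      by (auto simp del: mult_Suc mult_Suc_right)
  qed (auto simp del: mult_Suc mult_Suc_right)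
  let ?g = "\<lambda>(n, d). q ^ Suc n * real d"
  have g: "(\<lambda>(b, a). f (a, b)) (?j p) = ?g p" if "p \<in> ?D" for p
  proof -
    obtain n d where p: "p = (n, d)" by (cases p)
    with that obtain e where e: "Suc n = d * e" by auto
    hence "d > 0" "e > 0" by (auto intro: gr0I)
    thus ?thesis using e by (simp add: p f_def del: mult_Suc mult_Suc_right power_Suc)
  qed
  have "(\<lambda>p. (\<lambda>(b, a). f (a, b)) (?j p)) summable_on ?D"
    using sm' by (subst summable_on_reindex_bij_betw[OF bij])
  hence smg: "?g summable_on ?D" using g by (rule summable_on_cong[THEN iffD1, rotated])
  have "(\<Sum>b. q ^ Suc b / (1 - q ^ Suc b)\<^sup>2) = infsum (\<lambda>p. (\<lambda>(b, a). f (a, b)) (?j p)) ?D"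
    unfolding tot[symmetric] by (rule infsum_reindex_bij_betw[OF bij, symmetric])
  also have "\<dots> = infsum ?g ?D" using g by (rule infsum_cong)
  also have "\<dots> = (\<Sum>\<^sub>\<infinity>n. \<Sum>\<^sub>\<infinity>d\<in>{d. d dvd Suc n}. q ^ Suc n * real d)"
    using infsum_Sigma_banach[OF smg] by simp
  finally have eq: "(\<Sum>b. q ^ Suc b / (1 - q ^ Suc b)\<^sup>2) =
      (\<Sum>\<^sub>\<infinity>n. q ^ Suc n * real (\<Sum>d | d dvd Suc n. d))"
    by (simp add: sum_distrib_left del: power_Suc)
  have "(\<lambda>n. \<Sum>\<^sub>\<infinity>d\<in>{d. d dvd Suc n}. ?g (n, d)) summable_on UNIV"
    using summable_on_Sigma_banach[OF smg] by (simp only: prod.case)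
  hence "(\<lambda>n. q ^ Suc n * real (\<Sum>d | d dvd Suc n. d)) summable_on UNIV"
    by (simp add: sum_distrib_left del: power_Suc)
  hence "(\<lambda>n. q ^ Suc n * real (\<Sum>d | d dvd Suc n. d)) sums
      (\<Sum>\<^sub>\<infinity>n. q ^ Suc n * real (\<Sum>d | d dvd Suc n. d))"
    by (intro has_sum_imp_sums has_sum_infsum)
  hence "mean_size q = (\<Sum>b. q ^ Suc b / (1 - q ^ Suc b)\<^sup>2)"
    unfolding mean_size_def G2_def eq by (simp add: sums_iff)
  thus ?thesis using summable_sums[OF sm_rows] by simp
qed

text \<open>Pairing \<open>q^i\<close> with \<open>q^(n - i)\<close>, the inequality of arithmetic
  and geometric means bounds each pair below by \<open>2 * sqrt q ^ n\<close>. This supplies the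
  majorant for Tannery's theorem.\<close>

lemma geometric_sum_lower:
  fixes q :: real
  assumes "0 \<le> q"
  shows "real (Suc n) ^ 2 * q ^ n \<le> (\<Sum>i<Suc n. q ^ i)\<^sup>2"
proof -
  let ?s = "sqrt q" and ?S = "\<Sum>i<Suc n. q ^ i"
  have pw: "q ^ i = (?s ^ i)\<^sup>2" for i
  proof -
    have "(?s ^ i)\<^sup>2 = (?s\<^sup>2) ^ i" by (simp only: power_mult[symmetric] mult.commute)
    thus ?thesis using assms by simp
  qed
  have "2 * (real (Suc n) * ?s ^ n) = (\<Sum>i<Suc n. 2 * ?s ^ n)" by simp
  also have "\<dots> \<le> (\<Sum>i<Suc n. q ^ i + q ^ (Suc n - Suc i))"
  proof (rule sum_mono)
    fix i assume "i \<in> {..<Suc n}"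
    hence "?s ^ n = ?s ^ i * ?s ^ (n - i)" by (simp add: power_add[symmetric])
    moreover have "2 * ?s ^ i * ?s ^ (n - i) \<le> (?s ^ i)\<^sup>2 + (?s ^ (n - i))\<^sup>2"
      by (rule sum_squares_bound)
    ultimately show "2 * ?s ^ n \<le> q ^ i + q ^ (Suc n - Suc i)"
      by (simp add: pw mult.assoc)
  qed
  also have "\<dots> = 2 * ?S"
    using sum.nat_diff_reindex[of "\<lambda>i. q ^ i" "Suc n"] by (simp only: sum.distrib mult_2)
  finally have "real (Suc n) * ?s ^ n \<le> ?S" by simp
  hence "(real (Suc n) * ?s ^ n)\<^sup>2 \<le> ?S\<^sup>2"
    using assms by (intro power_mono) auto
  thus ?thesis by (simp only: power_mult_distrib pw)
qed

section \<open>Limits from the left at 1\<close>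

lemma eventually_left_of_one: "eventually (\<lambda>q::real. 0 < q \<and> q < 1) (at 1 within {0..<1})"
  unfolding eventually_at by (rule exI[of _ 1]) (auto simp: dist_real_def)

lemma left_of_one_neq_bot: "at (1::real) within {0..<1} \<noteq> bot"
proof -
  have "at_left (1::real) \<noteq> bot" by simp
  moreover have "at_left (1::real) = at 1 within {0..<1}"
    by (rule at_within_nhd[of _ "{0<..}"]) auto
  ultimately show ?thesis by simp
qed

text \<open>The factor \<open>(1 - q)^2\<close> cancels in every Lambert term, since
  \<open>1 - q ^ Suc b\<close> is \<open>1 - q\<close> times a geometric sum. The terms then tend to
  \<open>1 / (b + 1)^2\<close>, and the Basel series gives the value.\<close>

lemma mean_size_asymptotics:
  "((\<lambda>q. (1 - q)\<^sup>2 * mean_size q) \<longlongrightarrow> pi\<^sup>2 / 6) (at 1 within {0..<1})"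
proof -
  let ?F = "at (1::real) within {0..<1}"
  define a where "a b q = q ^ Suc b / (\<Sum>i<Suc b. q ^ i)\<^sup>2" for b and q :: real
  have "((\<lambda>q. suminf (\<lambda>b. a b q)) \<longlongrightarrow> (\<Sum>b. 1 / (real b + 1)\<^sup>2)) ?F"
  proof (rule tannerys_theorem[THEN conjunct2, THEN conjunct2])
    fix b
    have "(\<Sum>i<Suc b. (1::real) ^ i) \<noteq> 0" by simp
    hence "((\<lambda>q. a b q) \<longlongrightarrow> 1 ^ Suc b / (\<Sum>i<Suc b. 1 ^ i)\<^sup>2) ?F"
      unfolding a_def by (intro tendsto_intros) simp
    thus "((\<lambda>q. a b q) \<longlongrightarrow> 1 / (real b + 1)\<^sup>2) ?F" by (simp add: add.commute)
  next
    have "norm (a b q) \<le> 1 / (real b + 1)\<^sup>2" if q: "0 < q" "q < 1" for b q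
    proof -
      have S: "0 < (\<Sum>i<Suc b. q ^ i)" using q by (intro sum_pos) auto
      \<comment> \<open>One factor \<open>q\<close> is given away to match
        \<open>geometric_sum_lower\<close>; the resulting majorant is free of
        \<open>q\<close>.\<close>
      have "(real b + 1)\<^sup>2 * q ^ Suc b \<le> real (Suc b) ^ 2 * q ^ b"
        using q by (simp add: add.commute mult_left_le_one_le mult_left_mono)
      also have "\<dots> \<le> (\<Sum>i<Suc b. q ^ i)\<^sup>2" using q by (intro geometric_sum_lower) simp
      finally have "a b q \<le> 1 / (real b + 1)\<^sup>2"
        using S by (simp add: a_def divide_simps mult_ac del: sum.lessThan_Suc power_Suc)
      moreover have "0 \<le> a b q" using q by (simp add: a_def)
      ultimately show ?thesis by simp
    qed
    thus "eventually (\<lambda>(b, q). norm (a b q) \<le> 1 / (real b + 1)\<^sup>2) (at_top \<times>\<^sub>F ?F)"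
      unfolding eventually_prod_filter
      by (intro exI[of _ "\<lambda>_. True"] exI[of _ "\<lambda>q. 0 < q \<and> q < 1"])
        (auto intro: eventually_left_of_one)
    show "summable (\<lambda>b. 1 / (real b + 1)\<^sup>2)"
      using inverse_squares_sums by (simp add: sums_iff add.commute)
  qed (rule left_of_one_neq_bot)
  also have "(\<Sum>b. 1 / (real b + 1)\<^sup>2) = pi\<^sup>2 / 6"
    using inverse_squares_sums by (simp add: sums_iff add.commute)
  finally show ?thesis
  proof (rule Lim_transform_eventually)
    show "eventually (\<lambda>q. suminf (\<lambda>b. a b q) = (1 - q)\<^sup>2 * mean_size q) ?F"
      using eventually_left_of_one
    proof eventually_elim
      case (elim q)
      have a: "a b q = (1 - q)\<^sup>2 * (q ^ Suc b / (1 - q ^ Suc b)\<^sup>2)" for b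
      proof -
        have "(1 - q) * (\<Sum>i<Suc b. q ^ i) = 1 - q ^ Suc b"
          by (rule one_diff_power_eq[symmetric])
        hence "1 - q ^ Suc b = (1 - q) * (\<Sum>i<Suc b. q ^ i)" by simp
        thus ?thesis using elim by (simp add: a_def power_mult_distrib del: sum.lessThan_Suc power_Suc)
      qed
      have "(\<lambda>b. a b q) sums ((1 - q)\<^sup>2 * mean_size q)"
        unfolding a using elim by (intro sums_mult mean_size_sums) auto
      thus ?case by (rule sums_unique[symmetric])
    qed
  qed
qed

text \<open>The derivative of \<open>ln\<close> at 1 shows that \<open>- ln q\<close> is asymptotic
  to \<open>1 - q\<close>, which is then moved under the square root.\<close>

lemma minus_ln_mean_size_asymptotics:
  "((\<lambda>q. - ln q * sqrt (mean_size q)) \<longlongrightarrow> pi / sqrt 6) (at 1 within {0..<1})"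
proof -
  let ?F = "at (1::real) within {0..<1}"
  have "((\<lambda>q. (ln q - ln 1) / (q - 1)) \<longlongrightarrow> 1 / 1) (at (1::real))"
    using DERIV_ln_divide[of 1] unfolding has_field_derivative_iff by simp
  hence "((\<lambda>q. (ln q - ln 1) / (q - 1)) \<longlongrightarrow> 1) ?F"
    using tendsto_within_subset[of _ _ 1 UNIV] by simp
  moreover have "((\<lambda>q. sqrt ((1 - q)\<^sup>2 * mean_size q)) \<longlongrightarrow> sqrt (pi\<^sup>2 / 6)) ?F"
    by (intro tendsto_real_sqrt mean_size_asymptotics)
  ultimately have "((\<lambda>q. (ln q - ln 1) / (q - 1) * sqrt ((1 - q)\<^sup>2 * mean_size q))
      \<longlongrightarrow> 1 * sqrt (pi\<^sup>2 / 6)) ?F"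
    by (rule tendsto_mult)
  also have "1 * sqrt (pi\<^sup>2 / 6) = pi / sqrt 6" by (simp add: real_sqrt_divide)
  finally show ?thesis
  proof (rule Lim_transform_eventually)
    show "eventually (\<lambda>q. (ln q - ln 1) / (q - 1) * sqrt ((1 - q)\<^sup>2 * mean_size q) =
        - ln q * sqrt (mean_size q)) ?F"
      using eventually_left_of_one
    proof eventually_elim
      case (elim q)
      have eq: "sqrt ((1 - q)\<^sup>2 * mean_size q) = - (q - 1) * sqrt (mean_size q)"
        using elim by (simp add: real_sqrt_mult)
      have "a / d * (- d * s) = - a * s" if "d \<noteq> 0" for a d s :: real using that by simp
      moreover have "q - 1 \<noteq> 0" using elim by simp
      ultimately show ?case unfolding eq by (simp only: ln_one diff_zero)
    qed
  qed
qed

text \<open>As an exponential, \<open>q powr (- \<bar>x q\<bar>)\<close> has exponent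
  \<open>\<bar>x q / sqrt (mean_size q)\<bar>\<close> times
  \<open>- ln q * sqrt (mean_size q)\<close>, and both factors converge.\<close>

lemma site_weight_limit:
  assumes "((\<lambda>q. x q / sqrt (mean_size q)) \<longlongrightarrow> \<xi>) (at 1 within {0..<1})"
  shows "((\<lambda>q. inverse (1 + q powr (- \<bar>x q\<bar>))) \<longlongrightarrow> inverse (1 + exp (pi * \<bar>\<xi>\<bar> / sqrt 6)))
    (at 1 within {0..<1})"
proof -
  let ?F = "at (1::real) within {0..<1}" and ?n = "\<lambda>q. - ln q * sqrt (mean_size q)"
  have pos: "eventually (\<lambda>q. 0 < ?n q) ?F"
    using minus_ln_mean_size_asymptotics by (rule order_tendstoD(1)) simp
  have ne: "1 + exp t \<noteq> 0" for t :: real using exp_gt_zero[of t] by linarith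
  have "((\<lambda>q. inverse (1 + exp (\<bar>x q / sqrt (mean_size q)\<bar> * ?n q)))
      \<longlongrightarrow> inverse (1 + exp (\<bar>\<xi>\<bar> * (pi / sqrt 6)))) ?F"
    by (intro tendsto_intros assms minus_ln_mean_size_asymptotics ne)
  also have "\<bar>\<xi>\<bar> * (pi / sqrt 6) = pi * \<bar>\<xi>\<bar> / sqrt 6" by simp
  finally have lim: "((\<lambda>q. inverse (1 + exp (\<bar>x q / sqrt (mean_size q)\<bar> * ?n q)))
      \<longlongrightarrow> inverse (1 + exp (pi * \<bar>\<xi>\<bar> / sqrt 6))) ?F" .
  moreover have "eventually (\<lambda>q. inverse (1 + exp (\<bar>x q / sqrt (mean_size q)\<bar> * ?n q)) =
      inverse (1 + q powr (- \<bar>x q\<bar>))) ?F"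
    using eventually_left_of_one pos
  proof eventually_elim
    case (elim q)
    \<comment> \<open>Near 1 the product \<open>?n q\<close> is close to \<open>pi / sqrt 6\<close>
      and thus positive, so the square root is nonzero and really cancels.\<close>
    have "0 < sqrt (mean_size q)"
      by (rule zero_less_mult_pos[of "- ln q"]) (use elim in \<open>simp_all only: neg_0_less_iff_less ln_less_zero\<close>)
    hence "\<bar>x q / sqrt (mean_size q)\<bar> * ?n q = - \<bar>x q\<bar> * ln q" by (simp add: abs_divide)
    thus ?case using elim by (simp add: powr_def)
  qed
  ultimately show ?thesis by (rule Lim_transform_eventually)
qed

section \<open>The limit of the correlation function\<close>

lemma corr_bounds:
  fixes m :: nat and y :: "nat \<Rightarrow> real"
  assumes q: "0 < q" "q < 1" and half: "\<And>i. i \<in> {1..m} \<Longrightarrow> y i \<in> half_ints"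
    and inj: "inj_on y {1..m}"
  defines "P \<equiv> \<Prod>i\<in>{1..m}. inverse (1 + q powr (- \<bar>y i\<bar>))"
    and "K \<equiv> (2 * real m + 1) * m + real m ^ 2 / 2"
  shows "q powr K * P \<le> corr (y ` {1..m}) q" and "corr (y ` {1..m}) q \<le> q powr (- K) * P"
proof -
  let ?h = "\<lambda>k::int. of_int k + 1/2 :: real"
  \<comment> \<open>The floor of \<open>k + 1/2\<close> recovers the integer name \<open>k\<close>
    of the site.\<close>
  define k where "k i = \<lfloor>y i\<rfloor>" for i
  have k: "y i = ?h (k i)" if i: "i \<in> {1..m}" for i
  proof -
    obtain j :: int where j: "y i = of_int j + 1/2" using half[OF i] by (auto simp: half_ints_def)
    hence "\<lfloor>y i\<rfloor> = j" by linarith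
    thus ?thesis using j by (simp add: k_def)
  qed
  have inj_k: "inj_on k {1..m}"
    using inj k by (metis (no_types, lifting) inj_on_def)
  let ?X = "k ` {1..m}"
  have img: "y ` {1..m} = ?h ` ?X" using k by (auto simp: image_image)
  have card: "card ?X = m" using inj_k by (simp add: card_image)
  have P: "P = (\<Prod>k\<in>?X. inverse (1 + q powr (- \<bar>of_int k + 1/2\<bar>)))"
    unfolding P_def by (subst prod.reindex[OF inj_k]) (auto intro!: prod.cong simp: k)
  note c = corr_eq_Z_ratio[OF q, of ?X, folded img]
  show "q powr K * P \<le> corr (y ` {1..m}) q"
    using gibbs_ratio_bounds(1)[OF q _ card, folded P K_def] c by simp
  have "q powr K * corr (y ` {1..m}) q \<le> P"
    using gibbs_ratio_bounds(2)[OF q _ card, folded P K_def] c by simp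
  hence "q powr (- K) * (q powr K * corr (y ` {1..m}) q) \<le> q powr (- K) * P"
    by (intro mult_left_mono) auto
  thus "corr (y ` {1..m}) q \<le> q powr (- K) * P"
    using q by (simp add: mult.assoc[symmetric] powr_add[symmetric])
qed

theorem theorem7:
  fixes m :: nat and x :: "nat \<Rightarrow> real \<Rightarrow> real" and \<xi> :: "nat \<Rightarrow> real"
  assumes half: "\<And>q i. q \<in> {0..<1} \<Longrightarrow> i \<in> {1..m} \<Longrightarrow> x i q \<in> half_ints"
    and distinct: "\<And>q. q \<in> {0..<1} \<Longrightarrow> inj_on (\<lambda>i. x i q) {1..m}"
    and lim: "\<And>i. i \<in> {1..m} \<Longrightarrow>
      ((\<lambda>q. x i q / sqrt (mean_size q)) \<longlongrightarrow> \<xi> i) (at 1 within {0..<1})"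
  shows "((\<lambda>q. corr ((\<lambda>i. x i q) ` {1..m}) q) \<longlongrightarrow>
      (\<Prod>i\<in>{1..m}. inverse (1 + exp (pi * \<bar>\<xi> i\<bar> / sqrt 6)))) (at 1 within {0..<1})"
proof -
  let ?F = "at (1::real) within {0..<1}"
  let ?P = "\<lambda>q. \<Prod>i\<in>{1..m}. inverse (1 + q powr (- \<bar>x i q\<bar>))"
  let ?L = "\<Prod>i\<in>{1..m}. inverse (1 + exp (pi * \<bar>\<xi> i\<bar> / sqrt 6))"
  define K where "K = (2 * real m + 1) * m + real m ^ 2 / 2"
  have P: "(?P \<longlongrightarrow> ?L) ?F"
    using lim by (intro tendsto_prod site_weight_limit)
  \<comment> \<open>\<open>K\<close> depends on \<open>m\<close> alone, so the error factors
    \<open>q powr K\<close> and \<open>q powr (- K)\<close> tend to 1 however the points move with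
    \<open>q\<close>.\<close>
  have pw: "((\<lambda>q. q powr t) \<longlongrightarrow> 1) ?F" for t :: real
  proof -
    have "((\<lambda>q. q powr t) \<longlongrightarrow> 1 powr t) ?F" by (intro tendsto_intros) simp
    thus ?thesis by simp
  qed
  have sq: "((\<lambda>q. q powr t * ?P q) \<longlongrightarrow> ?L) ?F" for t :: real
    using tendsto_mult[OF pw P] by simp
  show ?thesis
  proof (rule tendsto_sandwich[OF _ _ sq[of K] sq[of "- K"]])
    show "eventually (\<lambda>q. q powr K * ?P q \<le> corr ((\<lambda>i. x i q) ` {1..m}) q) ?F"
      using eventually_left_of_one unfolding K_def
      by eventually_elim (rule corr_bounds(1); use half distinct in auto)
    show "eventually (\<lambda>q. corr ((\<lambda>i. x i q) ` {1..m}) q \<le> q powr (- K) * ?P q) ?F"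
      using eventually_left_of_one unfolding K_def
      by eventually_elim (rule corr_bounds(2); use half distinct in auto)
  qed
qed

end
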